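(* For each $n$ let $2\le k=k_n\le n$ and $\rho=\rho_n\in(0,1]$, and let $\mathcal C=\mathcal C_n$ be the class of all subsets of $\{1,\dots,n\}$ of size $k$. Assume that, as $n\to\infty$, $k^2/n\to0$ and $k/\log n\to\infty$. Let $m=m_n$ be integers with $(n/k^2)\log n\ll m\ll n/\log n$, and suppose $(1-\rho)^{1/2}\ll1/m$. Let $H_i=\Phi(X_i)$, $i=1,\dots,n$, where $\Phi$ is the standard normal distribution function; partition $[0,1]$ into $m$ intervals (bins) $I_1,\dots,I_m$ of length $1/m$; and let $B_s=\#\{i:H_i\in I_s\}$. Then the goodness-of-fit test $f$ defined by $$f(X)=0\iff\max_{s=1,\dots,m}B_s\le t,\qquad t=\frac nm+\sqrt{\frac{3n\log m}{m}},$$ has worst-case risk tending to zero under the general correlation model; that is, $$\mathbb P_0\{f(X)=1\}+\sup_{S\in\mathcal C}\ \sup_{\mathbf A\in\mathcal M_S(\rho)}\mathbf P_{X\sim\mathcal N(0,\mathbf A)}\{f(X)=0\}\to0\qquad(n\to\infty).$$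
   Context: $\mathbb P_0$ is the law of $X\sim\mathcal N(0,\mathbf I)$ on $\mathbb R^n$. $\mathcal M_S(\rho)$ is the set of $n\times n$ covariance matrices $\mathbf A$ with $\mathbf A_{i,i}=1$, $\mathbf A_{i,j}\ge\rho$ for $i\ne j$ with $i,j\in S$, and $\mathbf A_{i,j}=0$ otherwise. The notation $a_n\ll b_n$ means $a_n/b_n\to0$ as $n\to\infty$. *)

theory Defs
  imports "HOL-Probability.Probability" "Jordan_Normal_Form.Matrix"
begin

definition much_less :: "(nat \<Rightarrow> real) \<Rightarrow> (nat \<Rightarrow> real) \<Rightarrow> bool" (infix \<open>\<lless>\<close> 50)
  where "a \<lless> b \<longleftrightarrow> (\<lambda>n. a n / b n) \<longlonglongrightarrow> 0"

text \<open>The covariance matrices of order \<open>n\<close> are the symmetric positive semidefinite ones;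
  singular matrices are allowed (\<open>\<rho> = 1\<close> forces singularity).\<close>

definition covariance_mat :: "nat \<Rightarrow> real mat \<Rightarrow> bool"
  where "covariance_mat n A \<longleftrightarrow>
    A \<in> carrier_mat n n \<and> transpose_mat A = A \<and>
    (\<forall>v \<in> carrier_vec n. 0 \<le> scalar_prod v (A *\<^sub>v v))"

text \<open>The square root \<open>A\<^sup>1\<^sup>/\<^sup>2\<close>: the choice is immaterial, since a positive semidefinite matrix has
  exactly one positive semidefinite square root.\<close>

definition sqrt_mat :: "real mat \<Rightarrow> real mat"
  where "sqrt_mat A = (SOME R. covariance_mat (dim_row A) R \<and> R * R = A)"

text \<open>The law \<open>N(0, A)\<close> of \<open>A\<^sup>1\<^sup>/\<^sup>2 Z\<close>, where \<open>Z\<close> has independent standard normal coordinates.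
  Points of \<open>\<real>\<^sup>n\<close> are functions on the index set \<open>{..<n}\<close> (and \<open>undefined\<close> outside it), so
  coordinates are numbered \<open>0, \<dots>, n - 1\<close>, in accordance with the entries of matrices.\<close>

definition mvn :: "real mat \<Rightarrow> (nat \<Rightarrow> real) measure"
  where "mvn A = (let n = dim_row A in
    distr (\<Pi>\<^sub>M i\<in>{..<n}. std_normal_distribution) (\<Pi>\<^sub>M i\<in>{..<n}. borel)
      (\<lambda>z. \<lambda>i\<in>{..<n}. \<Sum>j<n. sqrt_mat A $$ (i, j) * z j))"

definition corr_class :: "nat \<Rightarrow> nat set \<Rightarrow> real \<Rightarrow> real mat set"
  where "corr_class n S \<rho> = {A. covariance_mat n A \<and>
    (\<forall>i<n. A $$ (i, i) = 1) \<and>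
    (\<forall>i<n. \<forall>j<n. i \<noteq> j \<longrightarrow>
      (if i \<in> S \<and> j \<in> S then A $$ (i, j) \<ge> \<rho> else A $$ (i, j) = 0))}"

definition Phi :: "real \<Rightarrow> real"
  where "Phi = cdf std_normal_distribution"

text \<open>The bins may be open, closed or half-open at either end, in any way that makes them a
  partition. The covering condition forces \<open>m > 0\<close>.\<close>

definition bin_partition :: "nat \<Rightarrow> (nat \<Rightarrow> real set) \<Rightarrow> bool"
  where "bin_partition m I \<longleftrightarrow>
    (\<forall>s\<in>{1..m}. is_interval (I s) \<and> measure lborel (I s) = 1 / real m) \<and>
    disjoint_family_on I {1..m} \<and> (\<Union>s\<in>{1..m}. I s) = {0..1}"

definition bin_count :: "nat \<Rightarrow> (nat \<Rightarrow> real set) \<Rightarrow> (nat \<Rightarrow> real) \<Rightarrow> nat \<Rightarrow> nat"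
  where "bin_count n I x s = card {i \<in> {..<n}. Phi (x i) \<in> I s}"

definition gof_test :: "nat \<Rightarrow> nat \<Rightarrow> (nat \<Rightarrow> real set) \<Rightarrow> (nat \<Rightarrow> real) \<Rightarrow> nat"
  where "gof_test n m I x =
    (if real (MAX s\<in>{1..m}. bin_count n I x s)
        \<le> real n / real m + sqrt (3 * real n * ln (real m) / real m)
     then 0 else 1)"

end

theory Submission
  imports Defs "Jordan_Normal_Form.Determinant"
begin

text \<open>Under the null hypothesis each bin count is binomial with parameters \<open>n\<close> and \<open>1/m\<close>, and
  a Chernoff bound at deviation \<open>(3 n log m / m)\<^sup>1\<^sup>/\<^sup>2\<close> fails with probability at most
  \<open>m\<^sup>-\<^sup>6\<^sup>/\<^sup>5\<close>, which survives a union bound over the bins. Under the alternative, fix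
  \<open>i\<^sub>0 \<in> S\<close>. Since \<open>X\<^sub>i - X\<^bsub>i\<^sub>0\<^esub>\<close> has variance at most \<open>2 (1 - \<rho>) \<lless> 1 / m\<^sup>2\<close> for \<open>i \<in> S\<close> and
  \<open>\<Phi>\<close> is Lipschitz, more than half of the \<open>H\<^sub>i\<close> with \<open>i \<in> S\<close> fall within \<open>\<epsilon> / m\<close> of \<open>H\<^bsub>i\<^sub>0\<^esub>\<close>;
  as \<open>H\<^bsub>i\<^sub>0\<^esub>\<close> is uniform, it is within \<open>\<epsilon> / m\<close> of an end of its bin with probability at most
  \<open>2 \<epsilon>\<close>, so with high probability its bin catches them all. The coordinates outside \<open>S\<close> are independent and standard
  normal, and a second Chernoff bound, uniform over the bins, shows that each bin holds almost its
  expected share of them. Because this bound is uniform, independence between \<open>S\<close> and its complement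
  is never needed. The bin of \<open>H\<^bsub>i\<^sub>0\<^esub>\<close> therefore exceeds \<open>n / m\<close> by nearly \<open>k / 2\<close>, which is of larger
  order than the threshold.\<close>

subsection \<open>Positive semidefinite square roots\<close>

no_notation inner (infix \<open>\<bullet>\<close> 70)

lemma covariance_matD:
  assumes "covariance_mat n A"
  shows "A \<in> carrier_mat n n" "transpose_mat A = A"
    "v \<in> carrier_vec n \<Longrightarrow> 0 \<le> v \<bullet> (A *\<^sub>v v)"
  using assms by (auto simp: covariance_mat_def)

lemma scalar_prod_self_eq_0_iff:
  fixes v :: "real vec"
  assumes "v \<in> carrier_vec n"
  shows "v \<bullet> v = 0 \<longleftrightarrow> v = 0\<^sub>v n"
  using assms by (auto simp: scalar_prod_def sum_nonneg_eq_0_iff intro!: eq_vecI)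

lemma scalar_prod_self_nonneg: "0 \<le> v \<bullet> (v :: real vec)"
  by (auto simp: scalar_prod_def intro: sum_nonneg)

lemma symmetric_form:
  fixes A :: "'a::comm_semiring_0 mat"
  assumes "A \<in> carrier_mat n n" "transpose_mat A = A" "x \<in> carrier_vec n" "y \<in> carrier_vec n"
  shows "x \<bullet> (A *\<^sub>v y) = y \<bullet> (A *\<^sub>v x)"
  using transpose_vec_mult_scalar[OF assms(1,4,3)] assms
    comm_scalar_prod[of "A *\<^sub>v x" n y] by simp

lemma symmetric_form_combination:
  fixes A :: "real mat"
  assumes A: "A \<in> carrier_mat n n" "transpose_mat A = A"
    and x: "x \<in> carrier_vec n" and y: "y \<in> carrier_vec n"
  shows "(x + c \<cdot>\<^sub>v y) \<bullet> (A *\<^sub>v (x + c \<cdot>\<^sub>v y)) =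
    x \<bullet> (A *\<^sub>v x) + 2 * c * (y \<bullet> (A *\<^sub>v x)) + c\<^sup>2 * (y \<bullet> (A *\<^sub>v y))"
proof -
  have [simp]: "A *\<^sub>v x \<in> carrier_vec n" "A *\<^sub>v y \<in> carrier_vec n" "c \<cdot>\<^sub>v y \<in> carrier_vec n"
    "c \<cdot>\<^sub>v (A *\<^sub>v y) \<in> carrier_vec n" "x + c \<cdot>\<^sub>v y \<in> carrier_vec n"
    using A x y by auto
  have "A *\<^sub>v (x + c \<cdot>\<^sub>v y) = A *\<^sub>v x + c \<cdot>\<^sub>v (A *\<^sub>v y)"
    using A x y by (simp add: mult_add_distrib_mat_vec mult_mat_vec)
  moreover have "x \<bullet> (A *\<^sub>v y) = y \<bullet> (A *\<^sub>v x)"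
    by (rule symmetric_form) (use A x y in auto)
  ultimately show ?thesis
    using x y by (simp add: scalar_prod_add_distrib[of _ n] add_scalar_prod_distrib[of _ n]
        algebra_simps power2_eq_square)
qed

text \<open>With \<open>y = A x\<close>, the form at \<open>x + c y\<close> equals
  \<open>2 c |y|^2 + c^2 (y . A y)\<close>. Unless \<open>y = 0\<close>, this is negative for small
  negative \<open>c\<close>, contradicting semidefiniteness.\<close>

lemma psd_form_eq_0_imp_kernel:
  assumes A: "covariance_mat n A" and x: "x \<in> carrier_vec n" and 0: "x \<bullet> (A *\<^sub>v x) = 0"
  shows "A *\<^sub>v x = 0\<^sub>v n"
proof (rule ccontr)
  note AD = covariance_matD[OF A]
  define y where "y = A *\<^sub>v x"
  have y: "y \<in> carrier_vec n" using AD x by (simp add: y_def)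
  define a b where "a = y \<bullet> y" and "b = y \<bullet> (A *\<^sub>v y)"
  assume "\<not> ?thesis"
  then have "a \<noteq> 0" using scalar_prod_self_eq_0_iff[OF y] by (simp add: a_def y_def)
  then have a: "a > 0" using scalar_prod_self_nonneg[of y] by (simp add: a_def)
  have b: "b \<ge> 0" using AD(3)[OF y] by (simp add: b_def)
  \<comment> \<open>The summand 1 keeps the denominator positive when \<open>b = 0\<close>.\<close>
  define c where "c = - a / (b + 1)"
  have "0 \<le> (x + c \<cdot>\<^sub>v y) \<bullet> (A *\<^sub>v (x + c \<cdot>\<^sub>v y))"
    using x y by (intro AD(3)) auto
  also have "\<dots> = 2 * c * a + c\<^sup>2 * b"
    using symmetric_form_combination[OF AD(1,2) x y] 0 by (simp add: a_def b_def y_def)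
  also have "\<dots> = a\<^sup>2 / (b + 1) * (b / (b + 1) - 2)"
    by (simp add: c_def power2_eq_square right_diff_distrib)
  also have "\<dots> < 0"
    using a b by (intro mult_pos_neg) (auto simp: field_simps)
  finally show False by simp
qed

lemma form_eq_sum:
  fixes A :: "real mat"
  assumes "A \<in> carrier_mat n n"
  shows "vec n f \<bullet> (A *\<^sub>v vec n f) = (\<Sum>i<n. f i * (\<Sum>j<n. A $$ (i, j) * f j))"
  using assms by (auto simp: scalar_prod_def atLeast0LessThan row_def intro!: sum.cong)

lemma mat_unit_vec_col:
  fixes A :: "'a::semiring_1 mat"
  assumes "A \<in> carrier_mat n m" "i < m"
  shows "A *\<^sub>v unit_vec m i = col A i"
  using assms by (intro eq_vecI) auto

lemma transpose_smult_mat: "transpose_mat (c \<cdot>\<^sub>m A) = c \<cdot>\<^sub>m transpose_mat A"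
  by (rule eq_matI) auto

text \<open>The quadratic form attains its maximum on the unit sphere by compactness, and
  homogeneity of degree two carries the inequality to all vectors.\<close>

lemma rayleigh_maximum:
  fixes A :: "real mat"
  assumes A: "A \<in> carrier_mat n n" and n: "n > 0"
  obtains v where "v \<in> carrier_vec n" "v \<bullet> v = 1"
    "\<And>x. x \<in> carrier_vec n \<Longrightarrow> x \<bullet> (A *\<^sub>v x) \<le> (v \<bullet> (A *\<^sub>v v)) * (x \<bullet> x)"
proof -
  define q where "q f = (\<Sum>i<n. f i * (\<Sum>j<n. A $$ (i, j) * f j))" for f :: "nat \<Rightarrow> real"
  \<comment> \<open>The sphere is modelled in the product topology on functions, where compactness
    comes from Tychonoff's theorem. Coordinates from \<open>n\<close> on range freely over the
    interval and do not enter \<open>q\<close>.\<close>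
  define K where "K = PiE UNIV (\<lambda>_. {-1..1::real}) \<inter> {f. (\<Sum>i<n. (f i)\<^sup>2) = 1}"
  have "compact (PiE (UNIV :: nat set) (\<lambda>_. {-1..1::real}))"
    using compactin_PiE[of "\<lambda>_::nat. euclidean :: real topology" UNIV "\<lambda>_. {-1..1}"]
    by (simp add: euclidean_product_topology)
  moreover have "closed {f :: nat \<Rightarrow> real. (\<Sum>i<n. (f i)\<^sup>2) = 1}"
    by (intro closed_Collect_eq continuous_intros continuous_on_product_coordinates)
  ultimately have "compact K" unfolding K_def by (rule compact_Int_closed)
  moreover have "(\<lambda>i. if i = 0 then 1 else 0) \<in> K"
  proof -
    have "(\<Sum>i<n. (if i = 0 then 1 else 0 :: real)\<^sup>2) = (\<Sum>i<n. if i = 0 then 1 else 0)"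
      by (intro sum.cong) auto
    then show ?thesis using n by (auto simp: K_def)
  qed
  moreover have "continuous_on K q" unfolding q_def
    by (intro continuous_intros continuous_on_subset[OF continuous_on_product_coordinates]) auto
  ultimately obtain f where f: "f \<in> K" "\<And>g. g \<in> K \<Longrightarrow> q g \<le> q f"
    using continuous_attains_sup[of K q] by blast
  have sp: "vec n g \<bullet> vec n g = (\<Sum>i<n. (g i)\<^sup>2)" for g :: "nat \<Rightarrow> real"
    by (auto simp: scalar_prod_def atLeast0LessThan power2_eq_square intro!: sum.cong)
  show thesis
  proof
    show "vec n f \<in> carrier_vec n" "vec n f \<bullet> vec n f = 1"
      using f by (auto simp: K_def sp)
    fix x :: "real vec" assume x: "x \<in> carrier_vec n"
    show "x \<bullet> (A *\<^sub>v x) \<le> (vec n f \<bullet> (A *\<^sub>v vec n f)) * (x \<bullet> x)"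
    proof (cases "x \<bullet> x = 0")
      case True
      then have "x = 0\<^sub>v n" using scalar_prod_self_eq_0_iff[OF x] by simp
      then show ?thesis using A True by simp
    next
      case False
      define r where "r = sqrt (x \<bullet> x)"
      have r: "r > 0" "r\<^sup>2 = x \<bullet> x" using False scalar_prod_self_nonneg[of x] by (auto simp: r_def)
      define g where "g i = (if i < n then x $ i / r else 0)" for i
      have gx: "x = r \<cdot>\<^sub>v vec n g" using x r by (auto simp: g_def)
      have "x \<bullet> x = r\<^sup>2 * (\<Sum>i<n. (g i)\<^sup>2)"
        by (subst gx, subst gx) (simp add: sp power2_eq_square)
      then have s1: "(\<Sum>i<n. (g i)\<^sup>2) = 1" using r False by simp
      have "g i \<in> {-1..1}" for i
      proof (cases "i < n")
        case True
        then have "(g i)\<^sup>2 \<le> (\<Sum>i<n. (g i)\<^sup>2)"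
          by (intro member_le_sum) auto
        then show ?thesis using s1 abs_le_square_iff[of "g i" 1] by auto
      qed (simp add: g_def)
      with s1 have "g \<in> K" by (auto simp: K_def)
      then have "q g \<le> q f" by (rule f)
      moreover have "x \<bullet> (A *\<^sub>v x) = r\<^sup>2 * q g"
        by (subst gx, subst gx) (use A in \<open>simp add: mult_mat_vec[of _ n n] form_eq_sum q_def power2_eq_square\<close>)
      then have "x \<bullet> (A *\<^sub>v x) = q g * (x \<bullet> x)" using r(2) by simp
      moreover have "vec n f \<bullet> (A *\<^sub>v vec n f) = q f" unfolding form_eq_sum[OF A] q_def ..
      ultimately show ?thesis by (simp only: mult_right_mono[OF _ scalar_prod_self_nonneg])
    qed
  qed
qed

text \<open>For a Rayleigh maximizer \<open>v\<close> with value \<open>\<mu>\<close>, the matrix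
  \<open>\<mu> 1 - A\<close> is positive semidefinite and its form vanishes at \<open>v\<close>, so
  \<open>v\<close> lies in its kernel. If \<open>\<mu>\<close> were 0, the form of \<open>A\<close>
  would vanish identically and \<open>A\<close> would be zero.\<close>

lemma psd_nonzero_eigenvector:
  assumes A: "covariance_mat n A" and nz: "A \<noteq> 0\<^sub>m n n"
  obtains v \<mu> where "v \<in> carrier_vec n" "v \<bullet> v = 1" "\<mu> > 0" "A *\<^sub>v v = \<mu> \<cdot>\<^sub>v v"
proof -
  note AD = covariance_matD[OF A]
  have "n > 0" using nz AD(1) by (cases n) (auto intro!: eq_matI)
  then obtain v where v: "v \<in> carrier_vec n" "v \<bullet> v = 1"
    and max: "\<And>x. x \<in> carrier_vec n \<Longrightarrow> x \<bullet> (A *\<^sub>v x) \<le> (v \<bullet> (A *\<^sub>v v)) * (x \<bullet> x)"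
    using rayleigh_maximum[OF AD(1)] by blast
  define \<mu> where "\<mu> = v \<bullet> (A *\<^sub>v v)"
  define B where "B = \<mu> \<cdot>\<^sub>m 1\<^sub>m n - A"
  have Bx: "B *\<^sub>v x = \<mu> \<cdot>\<^sub>v x - A *\<^sub>v x" if "x \<in> carrier_vec n" for x
  proof -
    have "(\<mu> \<cdot>\<^sub>m 1\<^sub>m n) *\<^sub>v x = \<mu> \<cdot>\<^sub>v x"
      using that by (intro eq_vecI) (auto simp: smult_scalar_prod_distrib[of _ n])
    then show ?thesis
      using minus_mult_distrib_mat_vec[of "\<mu> \<cdot>\<^sub>m 1\<^sub>m n" n n A x] AD(1) that by (simp add: B_def)
  qed
  have xBx: "x \<bullet> (B *\<^sub>v x) = \<mu> * (x \<bullet> x) - x \<bullet> (A *\<^sub>v x)" if "x \<in> carrier_vec n" for x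
    using that AD(1) by (simp add: Bx scalar_prod_minus_distrib[of _ n])
  have Bc: "B \<in> carrier_mat n n" using AD(1) unfolding B_def by (rule minus_carrier_mat)
  have "transpose_mat B = B"
  proof (rule eq_matI)
    fix i j assume "i < dim_row B" "j < dim_col B"
    then have ij: "i < n" "j < n" using Bc by auto
    have "A $$ (i, j) = A $$ (j, i)"
      using AD(1,2) ij by (metis carrier_matD index_transpose_mat(1))
    then show "transpose_mat B $$ (i, j) = B $$ (i, j)"
      using ij AD(1) Bc by (simp add: B_def)
  qed (use Bc in auto)
  moreover have "0 \<le> x \<bullet> (B *\<^sub>v x)" if "x \<in> carrier_vec n" for x
    using max[OF that] xBx[OF that] by (simp add: \<mu>_def)
  ultimately have "covariance_mat n B" using Bc by (simp add: covariance_mat_def)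
  moreover have "v \<bullet> (B *\<^sub>v v) = 0" using xBx[OF v(1)] v(2) by (simp add: \<mu>_def)
  ultimately have "B *\<^sub>v v = 0\<^sub>v n" using psd_form_eq_0_imp_kernel v(1) by blast
  then have 0: "\<mu> \<cdot>\<^sub>v v - A *\<^sub>v v = 0\<^sub>v n" using Bx[OF v(1)] by simp
  have ev: "A *\<^sub>v v = \<mu> \<cdot>\<^sub>v v"
  proof (rule eq_vecI)
    fix i assume "i < dim_vec (\<mu> \<cdot>\<^sub>v v)"
    then have i: "i < n" using v by simp
    then have "(\<mu> \<cdot>\<^sub>v v - A *\<^sub>v v) $ i = 0" using 0 by simp
    then show "(A *\<^sub>v v) $ i = (\<mu> \<cdot>\<^sub>v v) $ i" using i v(1) AD(1) by simp
  qed (use v AD(1) in auto)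
  have "\<mu> \<noteq> 0"
  proof
    assume "\<mu> = 0"
    then have "x \<bullet> (A *\<^sub>v x) = 0" if "x \<in> carrier_vec n" for x
      using max[OF that] AD(3)[OF that] by (simp add: \<mu>_def)
    then have "A *\<^sub>v x = 0\<^sub>v n" if "x \<in> carrier_vec n" for x
      using psd_form_eq_0_imp_kernel[OF A] that by blast
    then have "A *\<^sub>v unit_vec n i = 0\<^sub>v n" for i by (simp only: unit_vec_carrier)
    then have "col A i = 0\<^sub>v n" if "i < n" for i using that mat_unit_vec_col[OF AD(1) that] by simp
    then have "A = 0\<^sub>m n n" using AD(1) by (intro eq_matI) (auto simp: vec_eq_iff)
    with nz show False by simp
  qed
  moreover have "\<mu> \<ge> 0" using AD(3)[OF v(1)] by (simp add: \<mu>_def)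
  ultimately have "\<mu> > 0" by simp
  then show thesis by (rule that[OF v _ ev])
qed

section \<open>Rank-one updates and existence of the square root\<close>

definition outer_prod :: "real vec \<Rightarrow> real mat"
  where "outer_prod v = mat (dim_vec v) (dim_vec v) (\<lambda>(i, j). v $ i * v $ j)"

lemma outer_prod_carrier [simp]: "v \<in> carrier_vec n \<Longrightarrow> outer_prod v \<in> carrier_mat n n"
  by (auto simp: outer_prod_def)

lemma transpose_outer_prod: "transpose_mat (outer_prod v) = outer_prod v"
  by (rule eq_matI) (auto simp: outer_prod_def)

lemma mat_eqI_mult_vec:
  fixes A B :: "'a::semiring_1 mat"
  assumes "A \<in> carrier_mat n n" "B \<in> carrier_mat n n"
    and "\<And>x. x \<in> carrier_vec n \<Longrightarrow> A *\<^sub>v x = B *\<^sub>v x"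
  shows "A = B"
proof (rule mat_col_eqI)
  fix i assume "i < dim_col B"
  then have "i < n" using assms by auto
  then show "col A i = col B i"
    using assms(3)[of "unit_vec n i"] assms(1,2) by (simp add: mat_unit_vec_col)
qed (use assms in auto)

lemma smult_outer_prod_mult_vec:
  assumes "v \<in> carrier_vec n" "x \<in> carrier_vec n"
  shows "(c \<cdot>\<^sub>m outer_prod v) *\<^sub>v x = (c * (v \<bullet> x)) \<cdot>\<^sub>v v"
  using assms
  by (auto simp: outer_prod_def scalar_prod_def sum_distrib_left mult_ac intro!: eq_vecI sum.cong)

lemma psd_add_outer_prod:
  assumes A: "covariance_mat n A" and v: "v \<in> carrier_vec n" and c: "c \<ge> 0"
  shows "covariance_mat n (A + c \<cdot>\<^sub>m outer_prod v)"
  unfolding covariance_mat_def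
proof (intro conjI ballI)
  note AD = covariance_matD[OF A]
  have carr: "c \<cdot>\<^sub>m outer_prod v \<in> carrier_mat n n" using v by simp
  show "A + c \<cdot>\<^sub>m outer_prod v \<in> carrier_mat n n" using carr by simp
  show "transpose_mat (A + c \<cdot>\<^sub>m outer_prod v) = A + c \<cdot>\<^sub>m outer_prod v"
    using carr AD by (simp add: transpose_add[of _ n n] transpose_smult_mat transpose_outer_prod)
  fix x :: "real vec" assume x: "x \<in> carrier_vec n"
  have "x \<bullet> ((A + c \<cdot>\<^sub>m outer_prod v) *\<^sub>v x) = x \<bullet> (A *\<^sub>v x) + c * (v \<bullet> x)\<^sup>2"
    using AD(1) carr x v
    by (simp add: add_mult_distrib_mat_vec[of _ n n] smult_outer_prod_mult_vec
        scalar_prod_add_distrib[of _ n] comm_scalar_prod[of x n v] power2_eq_square)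
  then show "0 \<le> x \<bullet> ((A + c \<cdot>\<^sub>m outer_prod v) *\<^sub>v x)"
    using AD(3)[OF x] c by simp
qed

text \<open>The form of the deflated matrix at \<open>x\<close> is the form of \<open>A\<close> at
  \<open>x - (v . x) v\<close>, the component of \<open>x\<close> orthogonal to
  \<open>v\<close>.\<close>

lemma psd_deflate:
  assumes A: "covariance_mat n A" and v: "v \<in> carrier_vec n" "v \<bullet> v = 1"
    and ev: "A *\<^sub>v v = c \<cdot>\<^sub>v v"
  shows "covariance_mat n (A + (- c) \<cdot>\<^sub>m outer_prod v)"
  unfolding covariance_mat_def
proof (intro conjI ballI)
  note AD = covariance_matD[OF A]
  have carr: "(- c) \<cdot>\<^sub>m outer_prod v \<in> carrier_mat n n" using v by simp
  show "A + (- c) \<cdot>\<^sub>m outer_prod v \<in> carrier_mat n n" using carr by simp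
  show "transpose_mat (A + (- c) \<cdot>\<^sub>m outer_prod v) = A + (- c) \<cdot>\<^sub>m outer_prod v"
    using carr AD by (simp add: transpose_add[of _ n n] transpose_smult_mat transpose_outer_prod)
  fix x :: "real vec" assume x: "x \<in> carrier_vec n"
  have "x \<bullet> ((A + (- c) \<cdot>\<^sub>m outer_prod v) *\<^sub>v x) = x \<bullet> (A *\<^sub>v x) - c * (v \<bullet> x)\<^sup>2"
    using AD(1) carr x v
    by (simp add: add_mult_distrib_mat_vec[of _ n n] smult_outer_prod_mult_vec
        scalar_prod_add_distrib[of _ n] comm_scalar_prod[of x n v] power2_eq_square)
  also have "\<dots> = (x + (- (v \<bullet> x)) \<cdot>\<^sub>v v) \<bullet> (A *\<^sub>v (x + (- (v \<bullet> x)) \<cdot>\<^sub>v v))"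
    unfolding symmetric_form_combination[OF AD(1,2) x v(1)]
    using symmetric_form[OF AD(1,2) v(1) x] ev v x
    by (simp add: comm_scalar_prod[of x n v] power2_eq_square algebra_simps)
  also have "\<dots> \<ge> 0" using x v by (intro AD(3)) auto
  finally show "0 \<le> x \<bullet> ((A + (- c) \<cdot>\<^sub>m outer_prod v) *\<^sub>v x)" .
qed

text \<open>The square matrix \<open>U\<close> with columns \<open>u i\<close> has its transpose as
  left inverse, hence also as right inverse, and \<open>A = (A U) U^T = 0\<close>.\<close>

lemma orthonormal_kernel_imp_zero_mat:
  fixes A :: "real mat"
  assumes A: "A \<in> carrier_mat n n" and u: "\<And>i. i < n \<Longrightarrow> u i \<in> carrier_vec n"
    and orth: "\<And>i j. i < n \<Longrightarrow> j < n \<Longrightarrow> u i \<bullet> u j = (if i = j then 1 else 0)"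
    and ker: "\<And>i. i < n \<Longrightarrow> A *\<^sub>v u i = 0\<^sub>v n"
  shows "A = 0\<^sub>m n n"
proof -
  define U where "U = mat_of_cols n (map u [0..<n])"
  have U: "U \<in> carrier_mat n n" unfolding U_def by auto
  have cU: "col U i = u i" if "i < n" for i using that u by (simp add: U_def)
  have "transpose_mat U * U = 1\<^sub>m n"
    using U by (intro eq_matI) (auto simp: cU orth)
  then have "U * transpose_mat U = 1\<^sub>m n"
    using mat_mult_left_right_inverse[of "transpose_mat U" n U] U by simp
  moreover have "A * U = 0\<^sub>m n n"
  proof (rule eq_matI)
    fix i j assume ij: "i < dim_row (0\<^sub>m n n :: real mat)" "j < dim_col (0\<^sub>m n n :: real mat)"
    have "(A * U) $$ (i, j) = (A *\<^sub>v u j) $ i"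
      using ij A U by (simp add: cU)
    then show "(A * U) $$ (i, j) = 0\<^sub>m n n $$ (i, j)" using ij ker by simp
  qed (use A U in auto)
  ultimately show ?thesis
    using assoc_mult_mat[OF A U, of "transpose_mat U" n] U A by simp
qed

text \<open>Splitting off an eigenvector increases the orthonormal family \<open>u\<close> in the kernel, so that
  the number \<open>k\<close> of missing vectors is the induction variable.\<close>

lemma psd_sqrt_exists_aux:
  assumes "covariance_mat n A" and "d + k = n" and "\<And>i. i < d \<Longrightarrow> u i \<in> carrier_vec n"
    and "\<And>i j. i < d \<Longrightarrow> j < d \<Longrightarrow> u i \<bullet> u j = (if i = j then 1 else 0)"
    and "\<And>i. i < d \<Longrightarrow> A *\<^sub>v u i = 0\<^sub>v n"
  shows "\<exists>R. covariance_mat n R \<and> R * R = A"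
  using assms
proof (induction k arbitrary: A d u)
  case 0
  then have "A = 0\<^sub>m n n"
    using orthonormal_kernel_imp_zero_mat[of A n u] covariance_matD(1) by auto
  then show ?case using 0 by (intro exI[of _ A]) auto
next
  case (Suc k)
  note A = Suc.prems(1) and u = Suc.prems(3) and orth = Suc.prems(4) and ker = Suc.prems(5)
  note AD = covariance_matD[OF A]
  show ?case
  proof (cases "A = 0\<^sub>m n n")
    case True
    then show ?thesis using A by (intro exI[of _ A]) auto
  next
    case False
    then obtain v c where v: "v \<in> carrier_vec n" "v \<bullet> v = 1" and c: "c > 0"
      and ev: "A *\<^sub>v v = c \<cdot>\<^sub>v v"
      using psd_nonzero_eigenvector[OF A] by blast
    define A' where "A' = A + (- c) \<cdot>\<^sub>m outer_prod v"
    have A': "covariance_mat n A'" unfolding A'_def by (rule psd_deflate[OF A v ev])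
    note AD' = covariance_matD[OF A']
    have A'x: "A' *\<^sub>v x = A *\<^sub>v x + (- c * (v \<bullet> x)) \<cdot>\<^sub>v v" if "x \<in> carrier_vec n" for x
      using that v AD(1)
      by (simp add: A'_def add_mult_distrib_mat_vec[of _ n n] smult_outer_prod_mult_vec)
    have A'v: "A' *\<^sub>v v = 0\<^sub>v n"
      using A'x[OF v(1)] v ev by (intro eq_vecI) auto
    \<comment> \<open>Eigenvectors of a symmetric matrix for different eigenvalues, here
      \<open>c > 0\<close> and 0, are orthogonal.\<close>
    have vu: "v \<bullet> u i = 0" if "i < d" for i
    proof -
      have "c * (u i \<bullet> v) = u i \<bullet> (A *\<^sub>v v)" using ev u[OF that] v by simp
      also have "\<dots> = v \<bullet> (A *\<^sub>v u i)" using symmetric_form[OF AD(1,2) u[OF that] v(1)] .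
      also have "\<dots> = 0" using ker[OF that] v by simp
      finally show ?thesis using c comm_scalar_prod[OF v(1) u[OF that]] by simp
    qed
    define u' where "u' = u(d := v)"
    obtain R where R: "covariance_mat n R" "R * R = A'"
    proof -
      have "\<exists>R. covariance_mat n R \<and> R * R = A'"
      proof (rule Suc.IH[of A' "Suc d" u'])
        fix i assume i: "i < Suc d"
        show "u' i \<in> carrier_vec n" using i u v by (auto simp: u'_def)
        show "A' *\<^sub>v u' i = 0\<^sub>v n"
          using i A'v A'x[OF u[of i]] ker[of i] vu[of i] v
          by (cases "i = d") (auto simp: u'_def)
        fix j assume j: "j < Suc d"
        show "u' i \<bullet> u' j = (if i = j then 1 else 0)"
          using i j orth[of i j] v vu[of i] vu[of j] comm_scalar_prod[OF u[of i] v(1)]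
          by (auto simp: u'_def less_Suc_eq)
      qed (use A' Suc.prems in auto)
      with that show thesis by blast
    qed
    note RD = covariance_matD[OF R(1)]
    \<comment> \<open>The squared norm of \<open>R v\<close> is
      \<open>v . (R R v) = v . (A' v) = 0\<close>, so the root of \<open>A'\<close> kills
      \<open>v\<close> as well.\<close>
    have "(R *\<^sub>v v) \<bullet> (R *\<^sub>v v) = v \<bullet> (R *\<^sub>v (R *\<^sub>v v))"
      by (rule symmetric_form[OF RD(1,2), symmetric]) (use v RD in auto)
    also have "R *\<^sub>v (R *\<^sub>v v) = 0\<^sub>v n"
      using assoc_mult_mat_vec[OF RD(1) RD(1) v(1)] R(2) A'v by simp
    also have "v \<bullet> 0\<^sub>v n = 0" using v by simp
    finally have Rv: "R *\<^sub>v v = 0\<^sub>v n"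
      using scalar_prod_self_eq_0_iff[of "R *\<^sub>v v" n] RD(1) v by auto
    \<comment> \<open>Since \<open>R v = 0\<close>, the cross terms in the square of
      \<open>Q\<close> vanish, and \<open>Q Q = A' + c v v^T = A\<close>.\<close>
    define Q where "Q = R + sqrt c \<cdot>\<^sub>m outer_prod v"
    have Q: "covariance_mat n Q" unfolding Q_def using psd_add_outer_prod[OF R(1) v(1)] c by simp
    note QD = covariance_matD[OF Q]
    have Qx: "Q *\<^sub>v x = R *\<^sub>v x + (sqrt c * (v \<bullet> x)) \<cdot>\<^sub>v v" if "x \<in> carrier_vec n" for x
      using that v RD(1)
      by (simp add: Q_def add_mult_distrib_mat_vec[of _ n n] smult_outer_prod_mult_vec)
    have "Q * Q = A"
    proof (rule mat_eqI_mult_vec[of _ n])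
      fix x :: "real vec" assume x: "x \<in> carrier_vec n"
      have Rx: "R *\<^sub>v x \<in> carrier_vec n" using RD x by simp
      have vRx: "v \<bullet> (R *\<^sub>v x) = 0"
        using symmetric_form[OF RD(1,2) v(1) x] Rv x by simp
      have "(Q * Q) *\<^sub>v x = Q *\<^sub>v (R *\<^sub>v x + (sqrt c * (v \<bullet> x)) \<cdot>\<^sub>v v)"
        using assoc_mult_mat_vec[OF QD(1) QD(1) x] Qx[OF x] by simp
      also have "\<dots> = Q *\<^sub>v (R *\<^sub>v x) + (sqrt c * (v \<bullet> x)) \<cdot>\<^sub>v (Q *\<^sub>v v)"
        using QD(1) Rx v by (simp add: mult_add_distrib_mat_vec mult_mat_vec)
      also have "Q *\<^sub>v (R *\<^sub>v x) = A' *\<^sub>v x"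
      proof -
        have "R *\<^sub>v (R *\<^sub>v x) = A' *\<^sub>v x"
          using assoc_mult_mat_vec[OF RD(1) RD(1) x] R(2) by simp
        then show ?thesis using Qx[OF Rx] vRx AD'(1) v x by (intro eq_vecI) auto
      qed
      also have "Q *\<^sub>v v = sqrt c \<cdot>\<^sub>v v"
        using Qx[OF v(1)] Rv v by (intro eq_vecI) auto
      also have "(sqrt c * (v \<bullet> x)) \<cdot>\<^sub>v (sqrt c \<cdot>\<^sub>v v) = (c * (v \<bullet> x)) \<cdot>\<^sub>v v"
      proof -
        have "sqrt c * (v \<bullet> x) * sqrt c = sqrt c * sqrt c * (v \<bullet> x)" by (simp only: mult_ac)
        also have "\<dots> = c * (v \<bullet> x)" using c by simp
        finally show ?thesis by (simp only: smult_smult_assoc)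
      qed
      also have "A' *\<^sub>v x + (c * (v \<bullet> x)) \<cdot>\<^sub>v v = A *\<^sub>v x"
        using A'x[OF x] AD(1) v x by (intro eq_vecI) auto
      finally show "(Q * Q) *\<^sub>v x = A *\<^sub>v x" .
    qed (use QD AD in auto)
    with Q show ?thesis by blast
  qed
qed

lemma psd_sqrt_exists:
  assumes "covariance_mat n A"
  shows "\<exists>R. covariance_mat n R \<and> R * R = A"
  using psd_sqrt_exists_aux[OF assms, of 0 n] by simp

section \<open>The chosen root, its rows, and the correlation class\<close>

lemma sqrt_mat:
  assumes "covariance_mat n A"
  shows "covariance_mat n (sqrt_mat A)" "sqrt_mat A * sqrt_mat A = A"
proof -
  have "dim_row A = n" using covariance_matD(1)[OF assms] by auto
  then show "covariance_mat n (sqrt_mat A)" "sqrt_mat A * sqrt_mat A = A"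
    using someI_ex[OF psd_sqrt_exists[OF assms]] by (auto simp: sqrt_mat_def)
qed

text \<open>From \<open>R\<^sup>2 v = v\<close> one gets \<open>(R + 1) (R v - v) = 0\<close>, and \<open>R + 1\<close> is positive definite.\<close>

lemma psd_fixes_vec_if_square_fixes_vec:
  assumes R: "covariance_mat n R" and v: "v \<in> carrier_vec n" and fixp: "(R * R) *\<^sub>v v = v"
  shows "R *\<^sub>v v = v"
proof -
  note RD = covariance_matD[OF R]
  define w where "w = R *\<^sub>v v - v"
  have w: "w \<in> carrier_vec n" using RD(1) v by (simp add: w_def)
  have "R *\<^sub>v w = v - R *\<^sub>v v"
    using RD(1) v fixp assoc_mult_mat_vec[OF RD(1) RD(1) v]
    by (simp add: w_def mult_minus_distrib_mat_vec[of _ n n])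
  also have "\<dots> = - w" using RD(1) v by (intro eq_vecI) (auto simp: w_def)
  finally have "w \<bullet> (R *\<^sub>v w) = - (w \<bullet> w)" using w by simp
  with RD(3)[OF w] scalar_prod_self_nonneg[of w] have "w \<bullet> w = 0" by simp
  then have "w = 0\<^sub>v n" using scalar_prod_self_eq_0_iff[OF w] by simp
  then show ?thesis
    using RD(1) v by (intro eq_vecI) (auto simp: w_def vec_eq_iff)
qed

text \<open>The hypothesis says that \<open>A\<close> fixes the unit vector at \<open>i\<close>;
  then so does the root, and symmetry turns its column into a row. Coordinates outside
  \<open>S\<close> will thus pass through the root unchanged.\<close>

lemma sqrt_mat_row_unit:
  assumes A: "covariance_mat n A" and i: "i < n"
    and unit: "\<And>j. j < n \<Longrightarrow> A $$ (j, i) = (if j = i then 1 else 0)" and j: "j < n"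
  shows "sqrt_mat A $$ (i, j) = (if i = j then 1 else 0)"
proof -
  note S = sqrt_mat[OF A]
  note RD = covariance_matD[OF S(1)]
  have "col A i = unit_vec n i"
    using covariance_matD(1)[OF A] unit i by (intro eq_vecI) auto
  then have "(sqrt_mat A * sqrt_mat A) *\<^sub>v unit_vec n i = unit_vec n i"
    using mat_unit_vec_col[OF covariance_matD(1)[OF A] i] by (simp only: S(2))
  then have "sqrt_mat A *\<^sub>v unit_vec n i = unit_vec n i"
    by (intro psd_fixes_vec_if_square_fixes_vec[OF S(1)]) auto
  then have "col (sqrt_mat A) i = unit_vec n i"
    using RD(1) i by (simp add: mat_unit_vec_col)
  then have "sqrt_mat A $$ (j, i) = (if i = j then 1 else 0)"
    using RD(1) i j by (auto simp: vec_eq_iff)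
  moreover have "sqrt_mat A $$ (i, j) = sqrt_mat A $$ (j, i)"
    using RD(1,2) i j by (metis carrier_matD index_transpose_mat(1))
  ultimately show ?thesis by simp
qed

text \<open>The root is symmetric, so its rows have Gram matrix \<open>A\<close>. Hence
  \<open>A\<close> is indeed the covariance matrix of the linear forms whose coefficients are these
  rows.\<close>

lemma sqrt_mat_rows_inner:
  assumes A: "covariance_mat n A" and ij: "i < n" "j < n"
  shows "(\<Sum>l<n. sqrt_mat A $$ (i, l) * sqrt_mat A $$ (j, l)) = A $$ (i, j)"
proof -
  note S = sqrt_mat[OF A]
  note RD = covariance_matD[OF S(1)]
  have sym: "sqrt_mat A $$ (j, l) = sqrt_mat A $$ (l, j)" if "l < n" for l
    using RD(1,2) ij that by (metis carrier_matD index_transpose_mat(1))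
  have "A $$ (i, j) = (sqrt_mat A * sqrt_mat A) $$ (i, j)" by (simp add: S)
  also have "\<dots> = (\<Sum>l<n. sqrt_mat A $$ (i, l) * sqrt_mat A $$ (l, j))"
    using RD(1) ij by (simp add: scalar_prod_def atLeast0LessThan)
  finally show ?thesis using sym by simp
qed

text \<open>This is the variance of \<open>X_i - X_j\<close> under \<open>mvn A\<close>; within
  \<open>S\<close> it is at most \<open>2 (1 - \<rho>)\<close>.\<close>

lemma sqrt_mat_row_diff_sq:
  assumes A: "covariance_mat n A" and ij: "i < n" "j < n"
  shows "(\<Sum>l<n. (sqrt_mat A $$ (i, l) - sqrt_mat A $$ (j, l))\<^sup>2) =
    A $$ (i, i) + A $$ (j, j) - 2 * A $$ (i, j)"
proof -
  have "(\<Sum>l<n. (sqrt_mat A $$ (i, l) - sqrt_mat A $$ (j, l))\<^sup>2) =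
    (\<Sum>l<n. sqrt_mat A $$ (i, l) * sqrt_mat A $$ (i, l)
      + sqrt_mat A $$ (j, l) * sqrt_mat A $$ (j, l)
      - 2 * (sqrt_mat A $$ (i, l) * sqrt_mat A $$ (j, l)))"
    by (intro sum.cong) (auto simp: power2_eq_square algebra_simps)
  also have "\<dots> = A $$ (i, i) + A $$ (j, j) - 2 * A $$ (i, j)"
    using ij by (simp only: sum.distrib sum_subtractf sum_distrib_left[symmetric] sqrt_mat_rows_inner[OF A])
  finally show ?thesis .
qed

lemma covariance_one_mat: "covariance_mat n (1\<^sub>m n)"
  by (auto simp: covariance_mat_def scalar_prod_self_nonneg)

text \<open>The witness has correlation 1 within \<open>S\<close> and 0 elsewhere. With
  \<open>s\<close> the indicator of \<open>S\<close> and \<open>y\<close> the part of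
  \<open>x\<close> off \<open>S\<close>, its form is \<open>(s . x)^2 + |y|^2\<close>. Nonemptiness
  is what makes the inner supremum of the risk subject to bounds.\<close>

lemma corr_class_nonempty:
  assumes "S \<subseteq> {..<n}" "\<rho> \<le> 1"
  shows "corr_class n S \<rho> \<noteq> {}"
proof -
  define A :: "real mat"
    where "A = mat n n (\<lambda>(i, j). if i = j \<or> i \<in> S \<and> j \<in> S then 1 else 0)"
  define s where "s = vec n (\<lambda>i. if i \<in> S then 1 else 0 :: real)"
  have A: "A \<in> carrier_mat n n" by (simp add: A_def)
  have "0 \<le> x \<bullet> (A *\<^sub>v x)" if x: "x \<in> carrier_vec n" for x
  proof -
    define y where "y = vec n (\<lambda>i. if i \<in> S then 0 else x $ i)"
    have "A *\<^sub>v x = (s \<bullet> x) \<cdot>\<^sub>v s + y"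
    proof (rule eq_vecI)
      fix i assume "i < dim_vec ((s \<bullet> x) \<cdot>\<^sub>v s + y)"
      then have i: "i < n" by (simp add: y_def)
      have "(A *\<^sub>v x) $ i = (\<Sum>j<n. A $$ (i, j) * x $ j)"
        using i A x by (simp add: scalar_prod_def atLeast0LessThan)
      also have "\<dots> = (if i \<in> S then \<Sum>j<n. (if j \<in> S then 1 else 0) * x $ j
          else \<Sum>j<n. if j = i then x $ j else 0)"
      proof -
        have "A $$ (i, j) * x $ j = (if i \<in> S then (if j \<in> S then 1 else 0) * x $ j
            else if j = i then x $ j else 0)" if "j < n" for j
          using i that by (auto simp: A_def)
        then have "(\<Sum>j<n. A $$ (i, j) * x $ j) =
            (\<Sum>j<n. if i \<in> S then (if j \<in> S then 1 else 0) * x $ j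
              else if j = i then x $ j else 0)"
          by (intro sum.cong refl) simp
        then show ?thesis by (cases "i \<in> S") simp_all
      qed
      also have "\<dots> = ((s \<bullet> x) \<cdot>\<^sub>v s + y) $ i"
        using i x by (auto simp: s_def y_def scalar_prod_def atLeast0LessThan intro!: sum.cong)
      finally show "(A *\<^sub>v x) $ i = ((s \<bullet> x) \<cdot>\<^sub>v s + y) $ i" .
    qed (use A in \<open>auto simp: y_def\<close>)
    moreover have "x \<bullet> y = y \<bullet> y"
      using x by (auto simp: y_def scalar_prod_def intro!: sum.cong)
    ultimately have "x \<bullet> (A *\<^sub>v x) = (s \<bullet> x)\<^sup>2 + y \<bullet> y"
      using x by (simp add: scalar_prod_add_distrib[of _ n] s_def y_def power2_eq_square comm_scalar_prod[of x n])
    then show ?thesis using scalar_prod_self_nonneg[of y] by simp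
  qed
  moreover have "transpose_mat A = A" by (rule eq_matI) (auto simp: A_def)
  ultimately have "covariance_mat n A" using A by (auto simp: covariance_mat_def)
  moreover have "A $$ (i, i) = 1" if "i < n" for i using that by (simp add: A_def)
  moreover have "if i \<in> S \<and> j \<in> S then A $$ (i, j) \<ge> \<rho> else A $$ (i, j) = 0"
    if "i < n" "j < n" "i \<noteq> j" for i j using that assms by (auto simp: A_def)
  ultimately have "A \<in> corr_class n S \<rho>" by (auto simp: corr_class_def)
  then show ?thesis by blast
qed

subsection \<open>Gaussian linear forms and counts\<close>

interpretation std_normal: real_distribution std_normal_distribution
  by (rule real_dist_normal_dist)

lemma std_normal_density_le_1: "std_normal_density x \<le> 1"
proof -
  have "1 / sqrt (2 * pi) * exp (- x\<^sup>2 / 2) \<le> 1 * 1"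
    using pi_gt3 by (intro mult_mono) (auto simp: divide_simps)
  then show ?thesis by (simp add: std_normal_density_def)
qed

lemma Phi_diff: "x < y \<Longrightarrow> Phi y - Phi x = measure std_normal_distribution {x<..y}"
  unfolding Phi_def by (rule std_normal.cdf_diff_eq)

lemma Phi_mono: "x \<le> y \<Longrightarrow> Phi x \<le> Phi y"
  unfolding Phi_def by (rule std_normal.cdf_nondecreasing)

text \<open>The density is at most 1, so an interval has mass at most its length. This turns
  closeness of coordinates into closeness of their positions among the bins.\<close>

lemma Phi_lipschitz: "\<bar>Phi x - Phi y\<bar> \<le> \<bar>x - y\<bar>"
proof -
  have *: "Phi y - Phi x \<le> y - x" if "x < y" for x y
  proof -
    have "emeasure std_normal_distribution {x<..y} =
        (\<integral>\<^sup>+ z. ennreal (std_normal_density z) * indicator {x<..y} z \<partial>lborel)"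
      by (subst emeasure_density) auto
    also have "\<dots> \<le> (\<integral>\<^sup>+ z. 1 * indicator {x<..y} z \<partial>lborel)"
      by (intro nn_integral_mono mult_right_mono) (auto simp: std_normal_density_le_1)
    also have "\<dots> = ennreal (y - x)" using that by simp
    finally show ?thesis
      unfolding Phi_diff[OF that] std_normal.emeasure_eq_measure using that by simp
  qed
  consider "x < y" | "x = y" | "y < x" by linarith
  then show ?thesis
    using *[of x y] *[of y x] Phi_mono[of x y] Phi_mono[of y x] by cases auto
qed

text \<open>The density is positive everywhere, so an interval of mass 0 would be a Lebesgue null
  set.\<close>

lemma Phi_strict_mono: "x < y \<Longrightarrow> Phi x < Phi y"
proof (rule ccontr)
  assume xy: "x < y" and "\<not> Phi x < Phi y"
  then have "measure std_normal_distribution {x<..y} = 0"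
    using Phi_diff[OF xy] Phi_mono[of x y] by simp
  then have "emeasure std_normal_distribution {x<..y} = 0"
    by (simp add: std_normal.emeasure_eq_measure)
  then have "(\<integral>\<^sup>+ z. ennreal (std_normal_density z) * indicator {x<..y} z \<partial>lborel) = 0"
    by (subst (asm) emeasure_density) auto
  then have "AE z in lborel. ennreal (std_normal_density z) * indicator {x<..y} z = 0"
    by (subst (asm) nn_integral_0_iff_AE) auto
  then have "AE z in lborel. z \<notin> {x<..y}"
    by eventually_elim
      (use normal_density_pos[of 1 0] in
        \<open>auto simp: indicator_def ennreal_eq_0_iff not_le[symmetric] split: if_splits\<close>)
  then have "emeasure lborel {x<..y} = 0"
    by (subst (asm) AE_iff_measurable[OF _ refl]) (auto simp: greaterThanAtMost_def greaterThan_def atMost_def Collect_conj_eq)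
  with xy show False by simp
qed

lemma continuous_on_Phi: "continuous_on UNIV Phi"
proof (rule continuous_onI)
  fix x e :: real assume "e > 0"
  then show "\<exists>d>0. \<forall>x'\<in>UNIV. dist x' x < d \<longrightarrow> dist (Phi x') (Phi x) \<le> e"
    by (intro exI[of _ e]) (auto simp: dist_real_def intro!: order_trans[OF Phi_lipschitz])
qed

lemma Phi_measurable [measurable]: "Phi \<in> borel_measurable borel"
  by (rule borel_measurable_continuous_onI[OF continuous_on_Phi])

lemma Phi_bounds: "0 < Phi x" "Phi x < 1"
proof -
  have "0 \<le> Phi y" "Phi y \<le> 1" for y
    by (auto simp: Phi_def std_normal.cdf_nonneg std_normal.cdf_bounded_prob)
  from this(1)[of "x - 1"] this(2)[of "x + 1"] show "0 < Phi x" "Phi x < 1"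
    using Phi_strict_mono[of "x - 1" x] Phi_strict_mono[of x "x + 1"] by auto
qed

lemma Phi_surj_unit:
  assumes "0 < u" "u < 1"
  obtains x where "Phi x = u"
proof -
  have "eventually (\<lambda>x. Phi x < u) at_bot"
    using std_normal.cdf_lim_at_bot assms by (auto simp: Phi_def dest: order_tendstoD)
  then obtain a where a: "Phi a < u" by (metis eventually_happens trivial_limit_at_bot_linorder)
  have "eventually (\<lambda>x. Phi x > u) at_top"
    using std_normal.cdf_lim_at_top_prob assms by (auto simp: Phi_def dest: order_tendstoD)
  then obtain b where b: "Phi b > u" by (metis eventually_happens trivial_limit_at_top_linorder)
  have "a \<le> b" using a b Phi_mono[of b a] by linarith
  then obtain x where "Phi x = u"
    using IVT'[of Phi a u b] a b continuous_on_subset[OF continuous_on_Phi] by auto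
  then show thesis by (rule that)
qed

text \<open>Probability integral transform, by comparing distribution functions: for
  \<open>u\<close> strictly between 0 and 1 the event \<open>Phi x \<le> u\<close> is the half-line
  ending at the preimage of \<open>u\<close>.\<close>

lemma distr_Phi_std_normal:
  "distr std_normal_distribution borel Phi = uniform_measure lborel {0..1}"
proof (rule cdf_unique)
  show "real_distribution (distr std_normal_distribution borel Phi)"
    by (auto intro!: real_distribution.intro std_normal.prob_space_distr simp: real_distribution_axioms_def)
  show "real_distribution (uniform_measure lborel {0..1::real})"
    by (auto intro!: real_distribution.intro prob_space_uniform_measure simp: real_distribution_axioms_def)
  show "cdf (distr std_normal_distribution borel Phi) = cdf (uniform_measure lborel {0..1})"
  proof
    fix u :: real
    have L: "cdf (distr std_normal_distribution borel Phi) u = measure std_normal_distribution {x. Phi x \<le> u}"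
      by (simp add: cdf_def measure_distr vimage_def)
    have R: "cdf (uniform_measure lborel {0..1}) u = measure lborel ({0..1} \<inter> {..u})"
      by (simp add: cdf_def measure_uniform_measure)
    consider "u \<le> 0" | "0 < u" "u < 1" | "1 \<le> u" by linarith
    then show "cdf (distr std_normal_distribution borel Phi) u = cdf (uniform_measure lborel {0..1}) u"
    proof cases
      case 1
      have "\<not> Phi x \<le> u" for x using 1 Phi_bounds(1)[of x] by linarith
      then have "{x. Phi x \<le> u} = {}" by blast
      moreover have "{0..1} \<inter> {..u} = (if u = 0 then {0} else {})" using 1 by auto
      ultimately show ?thesis unfolding L R by simp
    next
      case 2
      then obtain x where x: "Phi x = u" by (rule Phi_surj_unit)
      have "{y. Phi y \<le> u} = {..x}"
        using x Phi_mono[of _ x] Phi_strict_mono[of x] by (auto simp: not_le[symmetric] dest: leI)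
      moreover have "{0..1} \<inter> {..u} = {0..u}" using 2 by auto
      ultimately show ?thesis unfolding L R using x 2 by (simp add: Phi_def cdf_def)
    next
      case 3
      have "Phi x \<le> u" for x using 3 Phi_bounds(2)[of x] by linarith
      then have "{x. Phi x \<le> u} = UNIV" by blast
      moreover have "{0..1} \<inter> {..u} = {0..1}" using 3 by auto
      ultimately show ?thesis unfolding L R using std_normal.prob_space by simp
    qed
  qed
qed

lemma measure_Phi_in:
  assumes "B \<in> sets borel"
  shows "measure std_normal_distribution {x. Phi x \<in> B} = measure lborel ({0..1} \<inter> B)"
proof -
  have "measure std_normal_distribution {x. Phi x \<in> B} = measure (distr std_normal_distribution borel Phi) B"
    using assms by (simp add: measure_distr vimage_def)
  then show ?thesis
    using assms by (simp add: distr_Phi_std_normal measure_uniform_measure)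
qed

section \<open>Linear forms and counts under independent standard normal coordinates\<close>

definition std_normal_PiM :: "nat \<Rightarrow> (nat \<Rightarrow> real) measure"
  where "std_normal_PiM n = (\<Pi>\<^sub>M i\<in>{..<n}. std_normal_distribution)"

lemma sets_std_normal_PiM [measurable_cong]:
  "sets (std_normal_PiM n) = sets (\<Pi>\<^sub>M i\<in>{..<n}. borel)"
  unfolding std_normal_PiM_def by (intro sets_PiM_cong) auto

lemma prob_space_std_normal_PiM: "prob_space (std_normal_PiM n)"
  unfolding std_normal_PiM_def by (intro prob_space_PiM std_normal.prob_space_axioms)

lemma std_normal_PiM_integral_prod:
  fixes f :: "nat \<Rightarrow> real \<Rightarrow> 'b::{real_normed_field, banach, second_countable_topology}"
  assumes "\<And>i. i < n \<Longrightarrow> integrable std_normal_distribution (f i)"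
  shows "integrable (std_normal_PiM n) (\<lambda>z. \<Prod>i<n. f i (z i))"
    and "(\<integral>z. (\<Prod>i<n. f i (z i)) \<partial>std_normal_PiM n) = (\<Prod>i<n. integral\<^sup>L std_normal_distribution (f i))"
proof -
  interpret product_sigma_finite "\<lambda>_::nat. std_normal_distribution" ..
  show "integrable (std_normal_PiM n) (\<lambda>z. \<Prod>i<n. f i (z i))"
    unfolding std_normal_PiM_def using assms by (intro product_integrable_prod) auto
  show "(\<integral>z. (\<Prod>i<n. f i (z i)) \<partial>std_normal_PiM n) = (\<Prod>i<n. integral\<^sup>L std_normal_distribution (f i))"
    unfolding std_normal_PiM_def using assms by (intro product_integral_prod) auto
qed

text \<open>The characteristic function factors over the coordinates, and a product of Gaussian ones
  depends only on the sum of squared coefficients. Writing the law as that of a scaled standard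
  normal includes variance 0, which occurs for differences within \<open>S\<close> when
  \<open>\<rho> = 1\<close>.\<close>

lemma distr_std_normal_PiM_linear:
  "distr (std_normal_PiM n) borel (\<lambda>z. \<Sum>j<n. c j * z j) =
   distr std_normal_distribution borel (\<lambda>x. sqrt (\<Sum>j<n. (c j)\<^sup>2) * x)"
proof (rule Levy_uniqueness)
  interpret N: prob_space "std_normal_PiM n" by (rule prob_space_std_normal_PiM)
  let ?M1 = "distr (std_normal_PiM n) borel (\<lambda>z. \<Sum>j<n. c j * z j)"
  let ?s = "sqrt (\<Sum>j<n. (c j)\<^sup>2)"
  let ?M2 = "distr std_normal_distribution borel (\<lambda>x. ?s * x)"
  have m: "(\<lambda>z. \<Sum>j<n. c j * z j) \<in> borel_measurable (std_normal_PiM n)" by measurable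
  show "real_distribution ?M1"
    using m by (auto intro!: real_distribution.intro N.prob_space_distr simp: real_distribution_axioms_def)
  show "real_distribution ?M2"
    by (auto intro!: real_distribution.intro std_normal.prob_space_distr simp: real_distribution_axioms_def)
  have ch: "(CLINT x|std_normal_distribution. iexp (t * x)) = exp (- of_real (t\<^sup>2 / 2))" for t
    using char_std_normal_distribution by (auto simp: char_def fun_eq_iff exp_of_real[symmetric])
  show "char ?M1 = char ?M2"
  proof
    fix t
    have "char ?M1 t = (CLINT z|std_normal_PiM n. iexp (t * (\<Sum>j<n. c j * z j)))"
      unfolding char_def by (subst integral_distr[OF m]) auto
    also have "\<dots> = (CLINT z|std_normal_PiM n. (\<Prod>j<n. iexp (t * c j * z j)))"
      by (simp add: sum_distrib_left exp_sum[symmetric] mult_ac)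
    also have "\<dots> = (\<Prod>j<n. CLINT x|std_normal_distribution. iexp (t * c j * x))"
      by (rule std_normal_PiM_integral_prod) (intro std_normal.integrable_iexp, auto)
    also have "\<dots> = (\<Prod>j<n. exp (- of_real ((t * c j)\<^sup>2 / 2)))"
      by (simp only: ch)
    also have "\<dots> = exp (\<Sum>j<n. - of_real ((t * c j)\<^sup>2 / 2))" by (simp add: exp_sum)
    also have "(\<Sum>j<n. - of_real ((t * c j)\<^sup>2 / 2)) = (- of_real ((t * ?s)\<^sup>2 / 2) :: complex)"
    proof -
      have "(\<Sum>j<n. (t * c j)\<^sup>2 / 2) = (t * ?s)\<^sup>2 / 2"
        by (simp add: power_mult_distrib sum_nonneg sum_distrib_left sum_divide_distrib)
      then show ?thesis by (simp only: sum_negf of_real_sum[symmetric])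
    qed
    also have "exp \<dots> = (CLINT x|std_normal_distribution. iexp (t * ?s * x))" by (rule ch[symmetric])
    also have "\<dots> = char ?M2 t"
      unfolding char_def by (subst integral_distr) (auto simp: mult_ac)
    finally show "char ?M1 t = char ?M2 t" .
  qed
qed

text \<open>A centred normal variable of variance \<open>v\<close> has mean absolute value
  \<open>sqrt v * sqrt (2 / pi)\<close>, and \<open>pi\<close> exceeds 2.\<close>

lemma expectation_abs_linear_le:
  assumes "(\<Sum>j<n. (c j)\<^sup>2) = v"
  shows "integrable (std_normal_PiM n) (\<lambda>z. \<bar>\<Sum>j<n. c j * z j\<bar>)"
    and "(\<integral>z. \<bar>\<Sum>j<n. c j * z j\<bar> \<partial>std_normal_PiM n) \<le> sqrt v"
proof -
  have v: "v \<ge> 0" unfolding assms[symmetric] by (intro sum_nonneg) auto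
  have m: "(\<lambda>z. \<Sum>j<n. c j * z j) \<in> borel_measurable (std_normal_PiM n)" by measurable
  have i: "integrable std_normal_distribution (\<lambda>x. \<bar>x\<bar>)"
    using integrable_abs[OF integrable_std_normal_distribution_moment[of 1]] by simp
  have "integrable (distr std_normal_distribution borel (\<lambda>x. sqrt v * x)) (\<lambda>x. \<bar>x\<bar>)"
    by (subst integrable_distr_eq) (use i in \<open>auto simp: abs_mult\<close>)
  then have "integrable (distr (std_normal_PiM n) borel (\<lambda>z. \<Sum>j<n. c j * z j)) (\<lambda>x. \<bar>x\<bar>)"
    by (simp add: distr_std_normal_PiM_linear assms)
  then show "integrable (std_normal_PiM n) (\<lambda>z. \<bar>\<Sum>j<n. c j * z j\<bar>)"
    by (subst (asm) integrable_distr_eq[OF m]) auto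
  have "(\<integral>z. \<bar>\<Sum>j<n. c j * z j\<bar> \<partial>std_normal_PiM n) =
      (\<integral>x. \<bar>x\<bar> \<partial>distr (std_normal_PiM n) borel (\<lambda>z. \<Sum>j<n. c j * z j))"
    by (subst integral_distr[OF m]) auto
  also have "\<dots> = (\<integral>x. \<bar>x\<bar> \<partial>distr std_normal_distribution borel (\<lambda>x. sqrt v * x))"
    by (simp add: distr_std_normal_PiM_linear assms)
  also have "\<dots> = sqrt v * (\<integral>x. \<bar>x\<bar> \<partial>std_normal_distribution)"
    using v by (subst integral_distr) (auto simp: abs_mult)
  also have "(\<integral>x. \<bar>x\<bar> \<partial>std_normal_distribution) = sqrt (2 / pi)"
    using std_normal_distribution_odd_moments_abs[of 0] by simp
  also have "sqrt v * sqrt (2 / pi) \<le> sqrt v * 1"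
    using v pi_gt3 by (intro mult_left_mono) auto
  finally show "(\<integral>z. \<bar>\<Sum>j<n. c j * z j\<bar> \<partial>std_normal_PiM n) \<le> sqrt v" by simp
qed

text \<open>A form with unit coefficient norm is standard normal, so its image under
  \<open>Phi\<close> is uniform.\<close>

lemma measure_linear_Phi_in:
  assumes "(\<Sum>j<n. (c j)\<^sup>2) = 1" "B \<in> sets borel"
  shows "measure (std_normal_PiM n) {z \<in> space (std_normal_PiM n). Phi (\<Sum>j<n. c j * z j) \<in> B} =
    measure lborel ({0..1} \<inter> B)"
proof -
  have m: "(\<lambda>z. \<Sum>j<n. c j * z j) \<in> borel_measurable (std_normal_PiM n)" by measurable
  have B: "{x. Phi x \<in> B} \<in> sets borel" using assms(2) by measurable
  have "measure (std_normal_PiM n) {z \<in> space (std_normal_PiM n). Phi (\<Sum>j<n. c j * z j) \<in> B} =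
    measure (distr (std_normal_PiM n) borel (\<lambda>z. \<Sum>j<n. c j * z j)) {x. Phi x \<in> B}"
    using B by (subst measure_distr[OF m]) (auto intro!: arg_cong2[where f = measure])
  also have "\<dots> = measure std_normal_distribution {x. Phi x \<in> B}"
    using B by (simp add: distr_std_normal_PiM_linear assms measure_distr)
  finally show ?thesis using measure_Phi_in[OF assms(2)] by simp
qed

text \<open>Taylor expansion with remainder \<open>exp t / 2 * x^2\<close>, where
  \<open>exp t\<close> is at most 1.11. The constant \<open>6 / 10\<close> must stay below
  \<open>2 / 3\<close>: the null tail exponent is \<open>3 (1 - 6/10) = 12/10\<close>, and it has to
  exceed 1 to survive the union over the bins.\<close>

lemma exp_le_quadratic:
  fixes x :: real
  assumes "\<bar>x\<bar> \<le> 1 / 10"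
  shows "exp x \<le> 1 + x + 6 / 10 * x\<^sup>2"
proof -
  obtain t where t: "\<bar>t\<bar> \<le> \<bar>x\<bar>" "exp x = (\<Sum>m<2. x ^ m / fact m) + exp t / fact 2 * x ^ 2"
    using Maclaurin_exp_le[of x 2] by blast
  have "exp t \<le> exp (1 / 10)" using t assms by simp
  also have "\<dots> \<le> 1 + 1 / 10 + (1 / 10)\<^sup>2" by (rule exp_bound) auto
  finally have "exp t \<le> 12 / 10" by (simp add: power2_eq_square)
  then have "exp t / 2 * x\<^sup>2 \<le> 6 / 10 * x\<^sup>2" by (intro mult_right_mono) auto
  then show ?thesis using t(2) by (simp add: numeral_2_eq_2)
qed

text \<open>Exponential Markov inequality for the count, covering both tails through the sign of
  \<open>\<kappa>\<close>.\<close>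

lemma count_tail:
  assumes B: "B \<in> sets borel" and p: "measure lborel ({0..1} \<inter> B) = p"
    and J: "J \<subseteq> {..<n}" and \<kappa>: "\<bar>\<kappa>\<bar> \<le> 1 / 10"
  shows "measure (std_normal_PiM n) {z \<in> space (std_normal_PiM n).
      a \<le> \<kappa> * (real (card {i \<in> J. Phi (z i) \<in> B}) - real (card J) * p)}
    \<le> exp (- a + 6 / 10 * \<kappa>\<^sup>2 * (real (card J) * p))"
proof -
  interpret N: prob_space "std_normal_PiM n" by (rule prob_space_std_normal_PiM)
  have fin: "finite J" using J by (rule finite_subset) simp
  define \<mu> where "\<mu> = real (card J) * p"
  \<comment> \<open>One factor per coordinate, with product \<open>exp (\<kappa> * count)\<close>;
    coordinates outside \<open>J\<close> contribute 1. Independence then turns the moment generating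
    function into a power.\<close>
  define f :: "nat \<Rightarrow> real \<Rightarrow> real"
    where "f i = (\<lambda>x. if i \<in> J then 1 + (exp \<kappa> - 1) * indicator {x. Phi x \<in> B} x else 1)" for i
  have S: "{x. Phi x \<in> B} \<in> sets borel" using B by measurable
  have ind: "integrable std_normal_distribution (indicator {x. Phi x \<in> B} :: real \<Rightarrow> real)"
    using S by (intro std_normal.integrable_const_bound[where B = 1]) auto
  then have f: "integrable std_normal_distribution (f i)" for i
    by (cases "i \<in> J") (simp_all add: f_def)
  have If: "integral\<^sup>L std_normal_distribution (f i) = (if i \<in> J then 1 + (exp \<kappa> - 1) * p else 1)" for i
    using S p measure_Phi_in[OF B] std_normal.prob_space ind by (simp add: f_def)
  have prodf: "(\<Prod>i<n. f i (z i)) = exp (\<kappa> * real (card {i \<in> J. Phi (z i) \<in> B}))" for z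
  proof -
    have "(\<Prod>i<n. f i (z i)) = (\<Prod>i\<in>J. f i (z i))"
      using J by (intro prod.mono_neutral_right) (auto simp: f_def)
    also have "\<dots> = (\<Prod>i\<in>J. if Phi (z i) \<in> B then exp \<kappa> else 1)"
      by (intro prod.cong) (auto simp: f_def)
    also have "\<dots> = exp \<kappa> ^ card {i \<in> J. Phi (z i) \<in> B}"
      using fin by (simp add: prod.If_cases Int_def)
    also have "\<dots> = exp (\<kappa> * real (card {i \<in> J. Phi (z i) \<in> B}))"
      by (simp add: exp_of_nat_mult[symmetric] mult.commute)
    finally show ?thesis .
  qed
  have p0: "p \<ge> 0" using p by (auto simp flip: p)
  have "measure (std_normal_PiM n) {z \<in> space (std_normal_PiM n). exp (a + \<kappa> * \<mu>) \<le> (\<Prod>i<n. f i (z i))}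
    \<le> (\<integral>z. (\<Prod>i<n. f i (z i)) \<partial>std_normal_PiM n) / exp (a + \<kappa> * \<mu>)"
    by (rule integral_Markov_inequality_measure[OF std_normal_PiM_integral_prod(1)[OF f] sets.empty_sets])
       (auto simp: prodf)
  also have "(\<integral>z. (\<Prod>i<n. f i (z i)) \<partial>std_normal_PiM n) = (1 + (exp \<kappa> - 1) * p) ^ card J"
  proof -
    have "(\<integral>z. (\<Prod>i<n. f i (z i)) \<partial>std_normal_PiM n) = (\<Prod>i<n. if i \<in> J then 1 + (exp \<kappa> - 1) * p else 1)"
      by (subst std_normal_PiM_integral_prod(2)[OF f]) (simp add: If)
    also have "\<dots> = (\<Prod>i\<in>J. 1 + (exp \<kappa> - 1) * p)"
      using J by (subst prod.inter_restrict[symmetric]) (auto simp: Int_absorb1)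
    finally show ?thesis by simp
  qed
  also have "\<dots> \<le> exp ((exp \<kappa> - 1) * p) ^ card J"
  proof (rule power_mono)
    \<comment> \<open>Monotonicity of powers needs a nonnegative base; for negative
      \<open>\<kappa>\<close> this rests on writing the base as
      \<open>(1 - p) + exp \<kappa> * p\<close>.\<close>
    have "p \<le> 1" using measure_Phi_in[OF B] p std_normal.prob_le_1 by metis
    then have "(1 - p) + exp \<kappa> * p \<ge> 0" using p0 by (intro add_nonneg_nonneg mult_nonneg_nonneg) auto
    then show "0 \<le> 1 + (exp \<kappa> - 1) * p" by (simp add: algebra_simps)
  qed (rule exp_ge_add_one_self)
  also have "\<dots> = exp ((exp \<kappa> - 1) * \<mu>)"
    by (simp add: exp_of_nat_mult[symmetric] \<mu>_def mult_ac)
  also have "\<dots> / exp (a + \<kappa> * \<mu>) = exp ((exp \<kappa> - 1) * \<mu> - (a + \<kappa> * \<mu>))"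
    by (simp add: exp_diff)
  also have "\<dots> \<le> exp (- a + 6 / 10 * \<kappa>\<^sup>2 * \<mu>)"
  proof -
    have "(exp \<kappa> - 1) * \<mu> \<le> (\<kappa> + 6 / 10 * \<kappa>\<^sup>2) * \<mu>"
      using exp_le_quadratic[OF \<kappa>] p0 by (intro mult_right_mono) (auto simp: \<mu>_def)
    then show ?thesis by (simp add: algebra_simps)
  qed
  finally have *: "measure (std_normal_PiM n) {z \<in> space (std_normal_PiM n). exp (a + \<kappa> * \<mu>) \<le> (\<Prod>i<n. f i (z i))}
    \<le> exp (- a + 6 / 10 * \<kappa>\<^sup>2 * \<mu>)"
    by (simp add: divide_right_mono)
  have "exp (a + \<kappa> * \<mu>) \<le> (\<Prod>i<n. f i (z i)) \<longleftrightarrow> a \<le> \<kappa> * (real (card {i \<in> J. Phi (z i) \<in> B}) - \<mu>)" for z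
    unfolding prodf by (auto simp: algebra_simps)
  with * show ?thesis by (simp add: \<mu>_def)
qed

subsection \<open>Bins and the two error probabilities\<close>

text \<open>Infimum and supremum serve as endpoints. The two inclusions leave open which of them
  belong to the interval, matching the freedom in \<open>bin_partition\<close>.\<close>

lemma interval_endpoints:
  fixes I :: "real set"
  assumes "is_interval I" "bounded I"
  obtains a b where "{a<..<b} \<subseteq> I" "I \<subseteq> {a..b}"
proof (cases "I = {}")
  case True
  then show thesis by (intro that[of 0 0]) auto
next
  case False
  have bdd: "bdd_below I" "bdd_above I"
    using assms(2) by (auto simp: bounded_imp_bdd_below bounded_imp_bdd_above)
  show thesis
  proof
    show "I \<subseteq> {Inf I..Sup I}" using bdd by (auto intro: cInf_lower cSup_upper)
    show "{Inf I<..<Sup I} \<subseteq> I"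
    proof
      fix x assume x: "x \<in> {Inf I<..<Sup I}"
      then obtain y z where "y \<in> I" "y < x" "z \<in> I" "x < z"
        using False bdd by (auto simp: cInf_less_iff less_cSup_iff)
      then show "x \<in> I" using assms(1) unfolding is_interval_1 by (meson less_imp_le)
    qed
  qed
qed

lemma bounded_interval_borel:
  fixes I :: "real set"
  assumes "is_interval I" "bounded I"
  shows "I \<in> sets borel"
proof -
  obtain a b where ab: "{a<..<b} \<subseteq> I" "I \<subseteq> {a..b}" using assms by (rule interval_endpoints)
  have "I = {a<..<b} \<union> (I \<inter> {a, b})" 
  proof (intro equalityI subsetI)
    fix x assume x: "x \<in> I"
    then have "a \<le> x" "x \<le> b" using ab(2) by auto
    then show "x \<in> {a<..<b} \<union> (I \<inter> {a, b})" using x by auto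
  qed (use ab(1) in auto)
  moreover have "I \<inter> {a, b} \<in> sets borel"
    by (intro borel_closed finite_imp_closed) auto
  ultimately show ?thesis by (metis sets.Un borel_open open_greaterThanLessThan)
qed

lemma bin_partitionD:
  assumes "bin_partition m I"
  shows "m > 0" "s \<in> {1..m} \<Longrightarrow> is_interval (I s)" "s \<in> {1..m} \<Longrightarrow> I s \<subseteq> {0..1}"
    "s \<in> {1..m} \<Longrightarrow> I s \<in> sets borel" "s \<in> {1..m} \<Longrightarrow> measure lborel ({0..1} \<inter> I s) = 1 / real m"
    "h \<in> {0..1} \<Longrightarrow> \<exists>s\<in>{1..m}. h \<in> I s"
proof -
  have U: "(\<Union>s\<in>{1..m}. I s) = {0..1}" using assms by (simp add: bin_partition_def)
  show "m > 0" using U by (cases m) auto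
  show i: "is_interval (I s)" and sub: "I s \<subseteq> {0..1}" if "s \<in> {1..m}" for s
    using assms U that by (auto simp: bin_partition_def)
  show "I s \<in> sets borel" if "s \<in> {1..m}" for s
    using i[OF that] sub[OF that] by (intro bounded_interval_borel) (auto intro: bounded_subset[OF bounded_closed_interval])
  show "measure lborel ({0..1} \<inter> I s) = 1 / real m" if "s \<in> {1..m}" for s
    using assms sub[OF that] that by (simp add: Int_absorb1 bin_partition_def)
  show "\<exists>s\<in>{1..m}. h \<in> I s" if "h \<in> {0..1}" for h
    using U that by blast
qed

lemma gof_test_eq_0_iff:
  assumes "m > 0"
  shows "gof_test n m I x = 0 \<longleftrightarrow> (\<forall>s\<in>{1..m}. real (bin_count n I x s)
    \<le> real n / real m + sqrt (3 * real n * ln (real m) / real m))"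
proof -
  have "real (Max (bin_count n I x ` {1..m})) \<le> c \<longleftrightarrow> (\<forall>s\<in>{1..m}. real (bin_count n I x s) \<le> c)" for c
  proof
    assume "\<forall>s\<in>{1..m}. real (bin_count n I x s) \<le> c"
    moreover have "Max (bin_count n I x ` {1..m}) \<in> bin_count n I x ` {1..m}"
      using assms by (intro Max_in) auto
    ultimately show "real (Max (bin_count n I x ` {1..m})) \<le> c" by auto
  next
    assume "real (Max (bin_count n I x ` {1..m})) \<le> c"
    then show "\<forall>s\<in>{1..m}. real (bin_count n I x s) \<le> c"
      using Max_ge[of "bin_count n I x ` {1..m}"] by (force intro: order_trans[rotated])
  qed
  then show ?thesis by (simp add: gof_test_def)
qed

lemma gof_test_eq_1_iff: "gof_test n m I x = 1 \<longleftrightarrow> gof_test n m I x \<noteq> 0"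
  by (simp add: gof_test_def)

section \<open>Pulling events back to independent standard normals, and the tails over all
  bins\<close>

definition lin_img :: "nat \<Rightarrow> real mat \<Rightarrow> (nat \<Rightarrow> real) \<Rightarrow> nat \<Rightarrow> real"
  where "lin_img n A z = (\<lambda>i\<in>{..<n}. \<Sum>j<n. sqrt_mat A $$ (i, j) * z j)"

text \<open>Inclusion of the preimage in a measurable \<open>E\<close> suffices: if the set on the
  left is not measurable, \<open>measure\<close> takes its default value 0 there. The test can thus
  be handled without a measurability proof for it.\<close>

lemma measure_mvn_le:
  assumes A: "A \<in> carrier_mat n n" and E: "E \<in> sets (std_normal_PiM n)"
    and sub: "\<And>z. z \<in> space (std_normal_PiM n) \<Longrightarrow> Q (lin_img n A z) \<Longrightarrow> z \<in> E"
  shows "measure (mvn A) {x \<in> space (mvn A). Q x} \<le> measure (std_normal_PiM n) E"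
proof -
  interpret N: prob_space "std_normal_PiM n" by (rule prob_space_std_normal_PiM)
  have mvn: "mvn A = distr (std_normal_PiM n) (\<Pi>\<^sub>M i\<in>{..<n}. borel) (lin_img n A)"
    using A by (simp add: mvn_def lin_img_def[abs_def] std_normal_PiM_def)
  have m: "lin_img n A \<in> measurable (std_normal_PiM n) (\<Pi>\<^sub>M i\<in>{..<n}. borel)"
    unfolding lin_img_def[abs_def] by measurable
  show ?thesis
  proof (cases "{x \<in> space (mvn A). Q x} \<in> sets (mvn A)")
    case True
    then show ?thesis unfolding mvn
      by (subst measure_distr[OF m]) (use sub in \<open>auto intro!: N.finite_measure_mono E\<close>)
  qed (simp add: measure_notin_sets)
qed

lemma count_measurable:
  assumes J: "J \<subseteq> {..<n}" and B: "B \<in> sets borel"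
  shows "(\<lambda>z. real (card {i \<in> J. Phi (z i) \<in> B})) \<in> borel_measurable (std_normal_PiM n)"
proof -
  have fin: "finite J" using J by (rule finite_subset) simp
  have S: "{x. Phi x \<in> B} \<in> sets borel" using B by measurable
  have "real (card {i \<in> J. Phi (z i) \<in> B}) = (\<Sum>i\<in>J. indicator {x. Phi x \<in> B} (z i))" for z
    using fin by (simp add: indicator_def sum.If_cases Int_def)
  moreover have "(\<lambda>z. \<Sum>i\<in>J. indicator {x. Phi x \<in> B} (z i) :: real) \<in> borel_measurable (std_normal_PiM n)"
    using J by (intro borel_measurable_sum measurable_compose[OF _ borel_measurable_indicator[OF S]]) auto
  ultimately show ?thesis by simp
qed

text \<open>A union bound over the bins. It serves the null hypothesis with all coordinates and
  positive \<open>\<kappa>\<close>, and the alternative with the complement of \<open>S\<close> and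
  negative \<open>\<kappa>\<close>.\<close>

lemma bins_count_tail:
  fixes I :: "nat \<Rightarrow> real set" and a \<kappa> :: real
  assumes I: "bin_partition m I" and J: "J \<subseteq> {..<n}" and \<kappa>: "\<bar>\<kappa>\<bar> \<le> 1 / 10"
  defines "E \<equiv> (\<Union>s\<in>{1..m}. {z \<in> space (std_normal_PiM n).
      a \<le> \<kappa> * (real (card {i \<in> J. Phi (z i) \<in> I s}) - real (card J) / real m)})"
  shows "E \<in> sets (std_normal_PiM n)"
    and "measure (std_normal_PiM n) E \<le> real m * exp (- a + 6 / 10 * \<kappa>\<^sup>2 * (real n / real m))"
proof -
  interpret N: prob_space "std_normal_PiM n" by (rule prob_space_std_normal_PiM)
  note ID = bin_partitionD[OF I]
  define F where "F s = {z \<in> space (std_normal_PiM n).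
      a \<le> \<kappa> * (real (card {i \<in> J. Phi (z i) \<in> I s}) - real (card J) / real m)}" for s
  have F: "F s \<in> sets (std_normal_PiM n)" if "s \<in> {1..m}" for s
  proof -
    have [measurable]: "(\<lambda>z. real (card {i \<in> J. Phi (z i) \<in> I s})) \<in> borel_measurable (std_normal_PiM n)"
      using J ID(4)[OF that] by (rule count_measurable)
    show ?thesis unfolding F_def by measurable
  qed
  have EF: "E = (\<Union>s\<in>{1..m}. F s)" by (simp add: E_def F_def)
  show "E \<in> sets (std_normal_PiM n)" unfolding EF using F by auto
  have "measure (std_normal_PiM n) E \<le> (\<Sum>s\<in>{1..m}. measure (std_normal_PiM n) (F s))"
    unfolding EF using F by (intro N.finite_measure_subadditive_finite) auto
  also have "\<dots> \<le> (\<Sum>s\<in>{1..m}. exp (- a + 6 / 10 * \<kappa>\<^sup>2 * (real n / real m)))"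
  proof (rule sum_mono)
    fix s assume s: "s \<in> {1..m}"
    have "card J \<le> n" using card_mono[OF _ J] by simp
    have "measure (std_normal_PiM n) (F s) \<le> exp (- a + 6 / 10 * \<kappa>\<^sup>2 * (real (card J) * (1 / real m)))"
      using count_tail[OF ID(4)[OF s] ID(5)[OF s] J \<kappa>, of a] by (simp add: F_def)
    also have "\<dots> \<le> exp (- a + 6 / 10 * \<kappa>\<^sup>2 * (real n / real m))"
      using \<open>card J \<le> n\<close> by (simp add: mult_left_mono divide_right_mono)
    finally show "measure (std_normal_PiM n) (F s) \<le> exp (- a + 6 / 10 * \<kappa>\<^sup>2 * (real n / real m))" .
  qed
  finally show "measure (std_normal_PiM n) E \<le> real m * exp (- a + 6 / 10 * \<kappa>\<^sup>2 * (real n / real m))" by simp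
qed

text \<open>The identity holds pointwise and not only in law, so coordinates uncorrelated with all
  others inherit independence directly from \<open>z\<close>.\<close>

lemma lin_img_unit_column:
  assumes A: "covariance_mat n A" and i: "i < n"
    and unit: "\<And>j. j < n \<Longrightarrow> A $$ (j, i) = (if j = i then 1 else 0)"
  shows "lin_img n A z i = z i"
proof -
  have "lin_img n A z i = (\<Sum>j<n. if i = j then z j else 0)"
    unfolding lin_img_def restrict_apply' [OF lessThan_iff[THEN iffD2, OF i]]
    using sqrt_mat_row_unit[OF A i unit] by (intro sum.cong) auto
  then show ?thesis using i by simp
qed

lemma gof_test_type_1_error:
  assumes I: "bin_partition m I" and n: "n > 0" and m: "m \<ge> 2"
    and small: "sqrt (3 * real n * ln (real m) / real m) * real m / real n \<le> 1 / 10"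
  shows "measure (mvn (1\<^sub>m n)) {x \<in> space (mvn (1\<^sub>m n)). gof_test n m I x = 1}
    \<le> real m * exp (- (12 / 10) * ln (real m))"
proof -
  define t where "t = sqrt (3 * real n * ln (real m) / real m)"
  \<comment> \<open>This is the deviation relative to the mean \<open>n / m\<close>. It makes the
    exponent \<open>-(1 - 6/10) t^2 m / n = -(12/10) ln m\<close>, and \<open>small\<close> keeps it
    within the range of \<open>exp_le_quadratic\<close>.\<close>
  define \<kappa> where "\<kappa> = t * real m / real n"
  define E where "E = (\<Union>s\<in>{1..m}. {z \<in> space (std_normal_PiM n).
      \<kappa> * t \<le> \<kappa> * (real (card {i \<in> {..<n}. Phi (z i) \<in> I s}) - real (card {..<n}) / real m)})"
  have t: "t \<ge> 0" "t\<^sup>2 = 3 * real n * ln (real m) / real m" using m by (auto simp: t_def)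
  have \<kappa>: "\<kappa> \<ge> 0" "\<bar>\<kappa>\<bar> \<le> 1 / 10" using t small by (auto simp: \<kappa>_def t_def[symmetric])
  note tail = bins_count_tail[OF I subset_refl[of "{..<n}"] \<kappa>(2), where a = "\<kappa> * t", folded E_def]
  have "measure (mvn (1\<^sub>m n)) {x \<in> space (mvn (1\<^sub>m n)). gof_test n m I x = 1}
      \<le> measure (std_normal_PiM n) E"
  proof (rule measure_mvn_le)
    fix z assume z: "z \<in> space (std_normal_PiM n)" and "gof_test n m I (lin_img n (1\<^sub>m n) z) = 1"
    then obtain s where s: "s \<in> {1..m}"
      and big: "real (bin_count n I (lin_img n (1\<^sub>m n) z) s) > real n / real m + t"
      using gof_test_eq_0_iff[of m n I] m unfolding gof_test_eq_1_iff t_def by (auto simp: not_le)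
    have "bin_count n I (lin_img n (1\<^sub>m n) z) s = card {i \<in> {..<n}. Phi (z i) \<in> I s}"
      unfolding bin_count_def
      by (intro arg_cong[where f = card] Collect_cong conj_cong refl)
        (simp add: lin_img_unit_column[OF covariance_one_mat])
    then have "\<kappa> * t \<le> \<kappa> * (real (card {i \<in> {..<n}. Phi (z i) \<in> I s}) - real (card {..<n}) / real m)"
      using big \<kappa>(1) by (intro mult_left_mono) auto
    then show "z \<in> E" using s z unfolding E_def by blast
  qed (use tail in auto)
  also have "\<dots> \<le> real m * exp (- (\<kappa> * t) + 6 / 10 * \<kappa>\<^sup>2 * (real n / real m))" by (rule tail)
  also have "- (\<kappa> * t) + 6 / 10 * \<kappa>\<^sup>2 * (real n / real m) = - (4 / 10) * (t\<^sup>2 * real m / real n)"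
    using n m by (simp add: \<kappa>_def power2_eq_square field_simps)
  also have "\<dots> = - (12 / 10) * ln (real m)"
    using n m unfolding t(2) by (simp add: field_simps)
  finally show ?thesis .
qed

text \<open>\<open>W\<close> collects strips of width \<open>d\<close> at both ends of every bin. A
  point of a bin outside them is more than \<open>d\<close> away from both ends, so moving it by
  \<open>d\<close> keeps it in the open interval, whichever endpoints the bin contains.\<close>

lemma near_edge_measure:
  assumes I: "bin_partition m I" and d: "d > 0"
  obtains W where "W \<in> sets borel" "measure lborel ({0..1} \<inter> W) \<le> real m * (2 * d)"
    "\<And>s h h'. s \<in> {1..m} \<Longrightarrow> h \<in> I s \<Longrightarrow> h \<notin> W \<Longrightarrow> \<bar>h' - h\<bar> \<le> d \<Longrightarrow> h' \<in> I s"
proof -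
  note ID = bin_partitionD[OF I]
  have "\<exists>a b. {a<..<b} \<subseteq> I s \<and> I s \<subseteq> {a..b}" if "s \<in> {1..m}" for s
    using interval_endpoints[OF ID(2)[OF that]] ID(3)[OF that]
    by (metis bounded_subset bounded_closed_interval)
  then obtain a b where ab: "{a s<..<b s} \<subseteq> I s" "I s \<subseteq> {a s..b s}" if "s \<in> {1..m}" for s
    by metis
  define V where "V s = {a s..a s + d} \<union> {b s - d..b s}" for s
  define W where "W = (\<Union>s\<in>{1..m}. V s)"
  have V: "V s \<in> fmeasurable lborel" for s
    unfolding V_def by (intro fmeasurable.Un fmeasurableI) (auto simp: emeasure_lborel_Icc_eq)
  have W: "W \<in> fmeasurable lborel" unfolding W_def using V by (intro fmeasurable.finite_UN) auto
  show thesis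
  proof (rule that[of W])
    show "W \<in> sets borel" using W by (auto dest: fmeasurableD)
    have "measure lborel ({0..1} \<inter> W) \<le> measure lborel W"
      using W by (intro measure_mono_fmeasurable) auto
    also have "\<dots> \<le> (\<Sum>s\<in>{1..m}. measure lborel (V s))"
      unfolding W_def using fmeasurableD[OF V] by (intro measure_UNION_le) auto
    also have "\<dots> \<le> (\<Sum>s\<in>{1..m}. 2 * d)"
    proof (rule sum_mono)
      fix s
      have "measure lborel (V s) \<le> measure lborel {a s..a s + d} + measure lborel {b s - d..b s}"
        unfolding V_def by (intro measure_Un_le) auto
      then show "measure lborel (V s) \<le> 2 * d" using d by simp
    qed
    finally show "measure lborel ({0..1} \<inter> W) \<le> real m * (2 * d)" by simp
    fix s h h' assume s: "s \<in> {1..m}" and h: "h \<in> I s" "h \<notin> W" "\<bar>h' - h\<bar> \<le> d"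
    then have "h \<notin> V s" by (auto simp: W_def)
    moreover have "h \<in> {a s..b s}" using h(1) ab(2)[OF s] by blast
    ultimately have "h' \<in> {a s<..<b s}" using h(3) by (auto simp: V_def)
    then show "h' \<in> I s" using ab(1)[OF s] by blast
  qed
qed

text \<open>The three summands bound three exceptional events: \<open>E0\<close>, the reference
  coordinate is near a bin edge; \<open>E1\<close>, the members of \<open>S\<close> are too far from
  it on the whole; \<open>E2\<close>, some bin has too few coordinates from outside
  \<open>S\<close>. The parameter \<open>\<epsilon>\<close> trades \<open>E0\<close> against
  \<open>E1\<close>.\<close>

lemma gof_test_type_2_error:
  assumes I: "bin_partition m I" and n: "n \<ge> 2"
    and S: "S \<subseteq> {..<n}" "S \<noteq> {}" and A: "A \<in> corr_class n S \<rho>" and \<rho>: "\<rho> \<le> 1" and \<epsilon>: "\<epsilon> > 0"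
    and small: "sqrt (4 * real n * ln (real n) / real m) * real m / real n \<le> 1 / 10"
    and large: "real (card S) / real m + sqrt (3 * real n * ln (real m) / real m)
      + sqrt (4 * real n * ln (real n) / real m) \<le> real (card S) / 2"
  shows "measure (mvn A) {x \<in> space (mvn A). gof_test n m I x = 0}
    \<le> 2 * \<epsilon> + 2 * sqrt 2 * (real m * sqrt (1 - \<rho>)) / \<epsilon> + real m * exp (- (16 / 10) * ln (real n))"
proof -
  interpret N: prob_space "std_normal_PiM n" by (rule prob_space_std_normal_PiM)
  note ID = bin_partitionD[OF I]
  have cov: "covariance_mat n A" and diag: "\<And>i. i < n \<Longrightarrow> A $$ (i, i) = 1"
    and off: "\<And>i j. i < n \<Longrightarrow> j < n \<Longrightarrow> i \<noteq> j \<Longrightarrow> \<not> (i \<in> S \<and> j \<in> S) \<Longrightarrow> A $$ (i, j) = 0"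
    and on: "\<And>i j. i < n \<Longrightarrow> j < n \<Longrightarrow> i \<noteq> j \<Longrightarrow> i \<in> S \<Longrightarrow> j \<in> S \<Longrightarrow> \<rho> \<le> A $$ (i, j)"
    using A by (auto simp: corr_class_def)
  define k where "k = card S"
  have finS: "finite S" using S(1) by (rule finite_subset) simp
  have k: "k > 0" using S finS by (auto simp: k_def card_gt_0_iff)
  define t t' where "t = sqrt (3 * real n * ln (real m) / real m)"
    and "t' = sqrt (4 * real n * ln (real n) / real m)"
  define J where "J = {..<n} - S"
  have J: "J \<subseteq> {..<n}" by (auto simp: J_def)
  have cardJ: "real (card J) = real n - real k"
    using S finS card_mono[of "{..<n}" S] by (simp add: J_def k_def card_Diff_subset of_nat_diff)
  obtain i0 where i0: "i0 \<in> S" "i0 < n" using S by auto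
  define X where "X i z = (\<Sum>j<n. sqrt_mat A $$ (i, j) * z j)" for i and z :: "nat \<Rightarrow> real"
  have Xm [measurable]: "X i \<in> borel_measurable (std_normal_PiM n)" for i
    unfolding X_def[abs_def] by measurable
  have lin: "lin_img n A z i = X i z" if "i < n" for i z using that by (simp add: lin_img_def X_def)
  have Xout: "X i z = z i" if "i \<in> J" for i z
  proof -
    have i: "i < n" "i \<notin> S" using that by (auto simp: J_def)
    then have "lin_img n A z i = z i"
      using off diag by (intro lin_img_unit_column[OF cov]) auto
    then show ?thesis using lin i by simp
  qed
  \<comment> \<open>The edge strips of all \<open>m\<close> bins then have total length at most
    \<open>2 * \<epsilon>\<close>.\<close>
  define d where "d = \<epsilon> / real m"
  have d: "d > 0" using \<epsilon> ID(1) by (simp add: d_def)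
  obtain W where W: "W \<in> sets borel" "measure lborel ({0..1} \<inter> W) \<le> real m * (2 * d)"
    and stable: "\<And>s h h'. s \<in> {1..m} \<Longrightarrow> h \<in> I s \<Longrightarrow> h \<notin> W \<Longrightarrow> \<bar>h' - h\<bar> \<le> d \<Longrightarrow> h' \<in> I s"
    using near_edge_measure[OF I d] by metis

  define E0 where "E0 = {z \<in> space (std_normal_PiM n). Phi (X i0 z) \<in> W}"
  have E0: "E0 \<in> sets (std_normal_PiM n)" unfolding E0_def using W(1) by measurable
  have "measure (std_normal_PiM n) E0 = measure lborel ({0..1} \<inter> W)"
    unfolding E0_def X_def
    by (rule measure_linear_Phi_in[OF _ W(1)])
       (use sqrt_mat_rows_inner[OF cov i0(2) i0(2)] diag i0 in \<open>simp add: power2_eq_square\<close>)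
  also have "\<dots> \<le> 2 * \<epsilon>" using W(2) ID(1) by (simp add: d_def)
  finally have P0: "measure (std_normal_PiM n) E0 \<le> 2 * \<epsilon>" .

  \<comment> \<open>If \<open>D z\<close> is below \<open>k / 2 * d\<close>, fewer than
    \<open>k / 2\<close> members of \<open>S\<close> lie farther than \<open>d\<close> from the
    reference. Markov's inequality for this sum uses only individual first moments, whatever the
    dependence within \<open>S\<close>.\<close>
  define D where "D z = (\<Sum>i\<in>S. \<bar>X i z - X i0 z\<bar>)" for z
  define E1 where "E1 = {z \<in> space (std_normal_PiM n). real k / 2 * d \<le> D z}"
  have E1: "E1 \<in> sets (std_normal_PiM n)" unfolding E1_def D_def by measurable
  have diff: "integrable (std_normal_PiM n) (\<lambda>z. \<bar>X i z - X i0 z\<bar>)"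
    "(\<integral>z. \<bar>X i z - X i0 z\<bar> \<partial>std_normal_PiM n) \<le> sqrt (2 * (1 - \<rho>))" if "i \<in> S" for i
  proof -
    have i: "i < n" using that S by auto
    have eq: "X i z - X i0 z = (\<Sum>j<n. (sqrt_mat A $$ (i, j) - sqrt_mat A $$ (i0, j)) * z j)" for z
      by (simp add: X_def sum_subtractf left_diff_distrib)
    have v: "(\<Sum>j<n. (sqrt_mat A $$ (i, j) - sqrt_mat A $$ (i0, j))\<^sup>2) = 2 - 2 * A $$ (i, i0)"
      using sqrt_mat_row_diff_sq[OF cov i i0(2)] diag i i0 by simp
    \<comment> \<open>For \<open>i = i0\<close> the entry is the diagonal 1, and the bound is
      \<open>\<rho> \<le> 1\<close>.\<close>
    have "\<rho> \<le> A $$ (i, i0)" using on[OF i i0(2)] that i0 \<rho> diag by (cases "i = i0") auto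
    then have "sqrt (2 - 2 * A $$ (i, i0)) \<le> sqrt (2 * (1 - \<rho>))" by simp
    with expectation_abs_linear_le[OF v]
    show "integrable (std_normal_PiM n) (\<lambda>z. \<bar>X i z - X i0 z\<bar>)"
      "(\<integral>z. \<bar>X i z - X i0 z\<bar> \<partial>std_normal_PiM n) \<le> sqrt (2 * (1 - \<rho>))"
      unfolding eq by (blast, linarith)
  qed
  have "measure (std_normal_PiM n) E1 \<le> (\<integral>z. D z \<partial>std_normal_PiM n) / (real k / 2 * d)"
    unfolding E1_def
    by (rule integral_Markov_inequality_measure[OF _ sets.empty_sets])
       (use diff(1) k d in \<open>auto simp: D_def sum_nonneg\<close>)
  also have "(\<integral>z. D z \<partial>std_normal_PiM n) = (\<Sum>i\<in>S. \<integral>z. \<bar>X i z - X i0 z\<bar> \<partial>std_normal_PiM n)"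
    unfolding D_def using diff(1) by (intro Bochner_Integration.integral_sum) auto
  also have "\<dots> \<le> real k * sqrt (2 * (1 - \<rho>))"
    unfolding k_def using diff(2) by (intro sum_bounded_above) auto
  also have "real k * sqrt (2 * (1 - \<rho>)) / (real k / 2 * d) = 2 * sqrt 2 * (real m * sqrt (1 - \<rho>)) / \<epsilon>"
    using k ID(1) \<epsilon> by (simp only: d_def real_sqrt_mult) (simp add: field_simps)
  finally have P1: "measure (std_normal_PiM n) E1 \<le> 2 * sqrt 2 * (real m * sqrt (1 - \<rho>)) / \<epsilon>"
    using k d by (simp add: divide_right_mono)

  \<comment> \<open>The same choice as under the null hypothesis, applied below with sign reversed
    to obtain a lower tail. The constant 4 and \<open>ln n\<close> give probability \<open>n\<close>
    to the power \<open>-16/10\<close> per bin.\<close>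
  define \<kappa> where "\<kappa> = t' * real m / real n"
  have t': "t' > 0" "t'\<^sup>2 = 4 * real n * ln (real n) / real m" using n ID(1) by (auto simp: t'_def)
  have \<kappa>: "\<kappa> > 0" "\<bar>- \<kappa>\<bar> \<le> 1 / 10" using t' n ID(1) small by (auto simp: \<kappa>_def t'_def[symmetric])
  define E2 where "E2 = (\<Union>s\<in>{1..m}. {z \<in> space (std_normal_PiM n).
      \<kappa> * t' \<le> - \<kappa> * (real (card {i \<in> J. Phi (z i) \<in> I s}) - real (card J) / real m)})"
  note tail = bins_count_tail[OF I J \<kappa>(2), where a = "\<kappa> * t'", folded E2_def]
  have "- (\<kappa> * t') + 6 / 10 * (- \<kappa>)\<^sup>2 * (real n / real m) = - (4 / 10) * (t'\<^sup>2 * real m / real n)"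
    using n ID(1) by (simp add: \<kappa>_def power2_eq_square field_simps)
  also have "\<dots> = - (16 / 10) * ln (real n)"
    using n ID(1) unfolding t'(2) by (simp add: field_simps)
  finally have P2: "measure (std_normal_PiM n) E2 \<le> real m * exp (- (16 / 10) * ln (real n))"
    using tail(2) by simp

  have "measure (mvn A) {x \<in> space (mvn A). gof_test n m I x = 0}
      \<le> measure (std_normal_PiM n) (E0 \<union> E1 \<union> E2)"
  proof (rule measure_mvn_le)
    fix z assume z: "z \<in> space (std_normal_PiM n)" and acc: "gof_test n m I (lin_img n A z) = 0"
    show "z \<in> E0 \<union> E1 \<union> E2"
    proof (rule ccontr)
      assume bad: "z \<notin> E0 \<union> E1 \<union> E2"
      have "Phi (X i0 z) \<in> {0..1}" using Phi_bounds[of "X i0 z"] by simp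
      then obtain s where s: "s \<in> {1..m}" "Phi (X i0 z) \<in> I s" using ID(6) by blast
      have notW: "Phi (X i0 z) \<notin> W" using bad z by (auto simp: E0_def)
      \<comment> \<open>\<open>G\<close> lies in \<open>S\<close> and \<open>H\<close> in its
        complement, so they are disjoint; both fall in the bin \<open>s\<close> of the reference
        coordinate, and their sizes add up.\<close>
      define G where "G = {i \<in> S. \<bar>X i z - X i0 z\<bar> \<le> d}"
      define H where "H = {i \<in> J. Phi (z i) \<in> I s}"
      have finG: "finite G" "finite H" using finS J by (auto simp: G_def H_def intro: finite_subset)
      have "real (card (S - G)) * d = (\<Sum>i\<in>S - G. d)" by simp
      also have "\<dots> \<le> (\<Sum>i\<in>S - G. \<bar>X i z - X i0 z\<bar>)" by (intro sum_mono) (auto simp: G_def)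
      also have "\<dots> \<le> D z" unfolding D_def using finS by (intro sum_mono2) auto
      also have "D z < real k / 2 * d" using bad z by (auto simp: E1_def not_le)
      finally have "real (card (S - G)) < real k / 2" using d by simp
      moreover have "card S = card G + card (S - G)"
        using finS by (subst card_Un_disjoint[symmetric]) (auto simp: G_def intro!: arg_cong[where f = card])
      ultimately have cG: "real (card G) > real k / 2" by (simp add: k_def)
      have "z \<notin> E2" using bad by simp
      then have "- \<kappa> * (real (card H) - real (card J) / real m) < \<kappa> * t'"
        using s z unfolding E2_def H_def by (auto simp: not_le)
      then have "\<kappa> * (real (card J) / real m - real (card H)) < \<kappa> * t'" by (simp add: algebra_simps)
      then have cH: "real (card H) > real (card J) / real m - t'" using \<kappa>(1) by simp
      have "\<bar>Phi (X i z) - Phi (X i0 z)\<bar> \<le> d" if "i \<in> G" for i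
        using that Phi_lipschitz[of "X i z" "X i0 z"] by (auto simp: G_def)
      then have "Phi (X i z) \<in> I s" if "i \<in> G" for i using stable[OF s notW] that by blast
      then have "G \<union> H \<subseteq> {i \<in> {..<n}. Phi (lin_img n A z i) \<in> I s}"
        using S J Xout lin by (auto simp: G_def H_def)
      then have "card (G \<union> H) \<le> bin_count n I (lin_img n A z) s"
        unfolding bin_count_def by (intro card_mono) auto
      moreover have "card (G \<union> H) = card G + card H"
        using finG by (intro card_Un_disjoint) (auto simp: G_def H_def J_def)
      ultimately have "real (card G) + real (card H) \<le> real (bin_count n I (lin_img n A z) s)" by simp
      also have "\<dots> \<le> real n / real m + t"
        using acc s(1) gof_test_eq_0_iff[OF ID(1)] by (simp add: t_def)
      \<comment> \<open>Cancelling \<open>n / m\<close> leaves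
        \<open>k / 2 < k / m + t + t'\<close>, which \<open>large\<close> excludes. The loss
        \<open>k / m\<close> is the share of bin \<open>s\<close> that the \<open>k\<close>
        coordinates of \<open>S\<close> would have had.\<close>
      finally have "real k / 2 + ((real n - real k) / real m - t') < real n / real m + t"
        using cG cH cardJ by simp
      moreover have "real k / real m + t + t' \<le> real k / 2"
        using large by (simp add: k_def t_def t'_def)
      ultimately show False by (simp add: diff_divide_distrib)
    qed
  qed (use covariance_matD(1)[OF cov] E0 E1 tail(1) in auto)
  also have "\<dots> \<le> measure (std_normal_PiM n) E0 + measure (std_normal_PiM n) E1 + measure (std_normal_PiM n) E2"
    using measure_Un_le[of "E0 \<union> E1" "std_normal_PiM n" E2] measure_Un_le[of E0 "std_normal_PiM n" E1]
      E0 E1 tail(1) by simp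
  finally show ?thesis using P0 P1 P2 by linarith
qed

subsection \<open>Asymptotics\<close>

text \<open>Both bounds are carried together so that the lemma can be applied first to the inner and
  then to the outer supremum; the upper bound also supplies the boundedness behind the lower
  one.\<close>

lemma cSUP_between:
  fixes f :: "'a \<Rightarrow> 'b::conditionally_complete_lattice"
  assumes "A \<noteq> {}" "\<And>x. x \<in> A \<Longrightarrow> a \<le> f x \<and> f x \<le> b"
  shows "a \<le> (SUP x\<in>A. f x) \<and> (SUP x\<in>A. f x) \<le> b"
proof
  obtain x where "x \<in> A" using assms(1) by blast
  moreover have "bdd_above (f ` A)" using assms(2) by (intro bdd_aboveI2[of _ _ b]) auto
  ultimately show "a \<le> (SUP x\<in>A. f x)" using assms(2) by (intro cSUP_upper2) auto
  show "(SUP x\<in>A. f x) \<le> b" using assms by (intro cSUP_least) auto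
qed

text \<open>With \<open>q n = m sqrt (1 - \<rho>)\<close>, the summands stem in order from the type
  1 error, the bin edges, the spread within \<open>S\<close>, and the lower tails off
  \<open>S\<close>.\<close>

definition risk_bound :: "(nat \<Rightarrow> nat) \<Rightarrow> (nat \<Rightarrow> real) \<Rightarrow> nat \<Rightarrow> real"
  where "risk_bound m q n = exp (- (2 / 10) * ln (real (m n))) + 2 * (sqrt (q n) + 1 / real n)
    + 2 * sqrt 2 * sqrt (q n) + exp (- (6 / 10) * ln (real n))"

lemma risk_bound_tendsto_0:
  assumes m: "filterlim m at_top sequentially" and q: "q \<longlonglongrightarrow> 0"
  shows "risk_bound m q \<longlonglongrightarrow> 0"
proof -
  have e: "(\<lambda>n. exp (- c * ln (real (f n)))) \<longlonglongrightarrow> 0"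
    if "filterlim f at_top sequentially" "c > 0" for c and f :: "nat \<Rightarrow> nat"
  proof -
    have "filterlim (\<lambda>n. ln (real (f n))) at_top sequentially"
      by (rule filterlim_compose[OF ln_at_top
            filterlim_compose[OF filterlim_real_sequentially that(1)]])
    then have "filterlim (\<lambda>n. c * ln (real (f n))) at_top sequentially"
      using that(2) by (intro filterlim_tendsto_pos_mult_at_top[OF tendsto_const])
    then have "filterlim (\<lambda>n. - (c * ln (real (f n)))) at_bot sequentially"
      by (simp add: filterlim_uminus_at_top)
    then show ?thesis
      using filterlim_compose[OF exp_at_bot] by fastforce
  qed
  have "(\<lambda>n. sqrt (q n)) \<longlonglongrightarrow> 0" using tendsto_real_sqrt[OF q] by simp
  then have "(\<lambda>n. risk_bound m q n) \<longlonglongrightarrow> 0 + 2 * (0 + 0) + 2 * sqrt 2 * 0 + 0"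
    unfolding risk_bound_def
    by (intro tendsto_intros e m filterlim_ident lim_1_over_n) auto
  then show ?thesis by simp
qed

text \<open>Since \<open>m \<le> n\<close>, the null deviation is at most the other one,
  \<open>t'\<close>. The value \<open>1 / 400\<close> gives
  \<open>(t' m / n)^2 \<le> 1 / 100\<close>; the value \<open>1 / 1024\<close> gives
  \<open>t' \<le> k / 16\<close>; and \<open>m \<ge> 8\<close> gives
  \<open>k / m \<le> k / 8\<close>, for a total of at most \<open>k / 4\<close>. Finally
  \<open>n \<ge> 3\<close> ensures \<open>ln n \<ge> 1\<close>.\<close>

lemma threshold_deviation_bounds:
  fixes k m n :: nat
  assumes n: "n \<ge> 3" and k: "k > 0" and m: "m \<ge> 8"
    and sparse: "real n / real k ^ 2 * ln (real n) / real m \<le> 1 / 1024"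
    and fine: "real m / (real n / ln (real n)) \<le> 1 / 400"
  shows "real m \<le> real n"
    and "sqrt (3 * real n * ln (real m) / real m) * real m / real n \<le> 1 / 10"
    and "sqrt (4 * real n * ln (real n) / real m) * real m / real n \<le> 1 / 10"
    and "real k / real m + sqrt (3 * real n * ln (real m) / real m)
      + sqrt (4 * real n * ln (real n) / real m) \<le> real k / 2"
proof -
  have "exp 1 \<le> (3 :: real)" by (rule exp_le)
  then have "ln (exp 1) \<le> ln (real n)" using n by (subst ln_le_cancel_iff) auto
  then have ln: "ln (real n) \<ge> 1" by simp
  have mn: "real m * ln (real n) \<le> real n / 400" using fine n by (simp add: field_simps)
  moreover have "real m * 1 \<le> real m * ln (real n)" using ln by (intro mult_left_mono) auto
  ultimately show le: "real m \<le> real n" by linarith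
  define t t' where "t = sqrt (3 * real n * ln (real m) / real m)"
    and "t' = sqrt (4 * real n * ln (real n) / real m)"
  have "ln (real m) \<le> ln (real n)" using le m by simp
  moreover have "0 \<le> ln (real m)" using m by simp
  ultimately have "3 * real n * ln (real m) \<le> 4 * real n * ln (real n)" by (intro mult_mono) auto
  then have tt': "t \<le> t'" unfolding t_def t'_def
    using m by (intro real_sqrt_le_mono divide_right_mono) auto
  have "(t' * real m / real n)\<^sup>2 = 4 * (real m * ln (real n)) / real n"
    unfolding t'_def power_mult_distrib power_divide using n m ln
    by (simp add: power2_eq_square[of "real n"] power2_eq_square[of "real m"])
  also have "\<dots> \<le> (1 / 10)\<^sup>2" using mn n by (simp add: field_simps power2_eq_square)
  finally have t': "t' * real m / real n \<le> 1 / 10" by (rule power2_le_imp_le) simp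
  have "t * real m / real n \<le> t' * real m / real n"
    using tt' by (intro divide_right_mono mult_right_mono) auto
  with t' have "t * real m / real n \<le> 1 / 10" by linarith
  with t' show "sqrt (3 * real n * ln (real m) / real m) * real m / real n \<le> 1 / 10"
    "sqrt (4 * real n * ln (real n) / real m) * real m / real n \<le> 1 / 10"
    by (simp_all only: t_def t'_def)
  have "4 * real n * ln (real n) / real m \<le> (real k / 16)\<^sup>2"
    using sparse k m by (simp add: field_simps power2_eq_square)
  then have "t' \<le> real k / 16" unfolding t'_def by (intro real_le_lsqrt) auto
  moreover have "real k / real m \<le> real k / 8" using m by (intro divide_left_mono) auto
  ultimately have "real k / real m + t + t' \<le> real k / 2" using tt' by linarith
  then show "real k / real m + sqrt (3 * real n * ln (real m) / real m)
      + sqrt (4 * real n * ln (real n) / real m) \<le> real k / 2"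
    by (simp only: t_def t'_def)
qed

theorem proposition3p5:
  fixes k m :: "nat \<Rightarrow> nat" and \<rho> :: "nat \<Rightarrow> real"
    and I :: "nat \<Rightarrow> nat \<Rightarrow> real set"
  assumes "\<forall>n\<ge>2. 2 \<le> k n \<and> k n \<le> n"
    and "\<forall>n\<ge>2. \<rho> n \<in> {0<..1}"
    and "(\<lambda>n. real (k n) ^ 2 / real n) \<longlonglongrightarrow> 0"
    and "filterlim (\<lambda>n. real (k n) / ln (real n)) at_top sequentially"
    and "(\<lambda>n. real n / real (k n) ^ 2 * ln (real n)) \<lless> (\<lambda>n. real (m n))"
    and "(\<lambda>n. real (m n)) \<lless> (\<lambda>n. real n / ln (real n))"
    and "(\<lambda>n. sqrt (1 - \<rho> n)) \<lless> (\<lambda>n. 1 / real (m n))"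
    and "\<forall>n\<ge>2. bin_partition (m n) (I n)"
  shows "(\<lambda>n. measure (mvn (1\<^sub>m n))
           {x \<in> space (mvn (1\<^sub>m n)). gof_test n (m n) (I n) x = 1} +
         (SUP S\<in>{S. S \<subseteq> {..<n} \<and> card S = k n}. SUP A\<in>corr_class n S (\<rho> n).
           measure (mvn A) {x \<in> space (mvn A). gof_test n (m n) (I n) x = 0}))
         \<longlonglongrightarrow> 0"
proof -
  define q where "q n = real (m n) * sqrt (1 - \<rho> n)" for n
  have q: "q \<longlonglongrightarrow> 0"
    using assms(7) by (simp add: much_less_def q_def[abs_def] mult.commute)
  have sparse: "eventually (\<lambda>n. real n / real (k n) ^ 2 * ln (real n) / real (m n) < c) sequentially"
    if "c > 0" for c :: real
    using order_tendstoD(2)[OF assms(5)[unfolded much_less_def] that] .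
  have sparse_one: "eventually (\<lambda>n. real n / real (k n) ^ 2 * ln (real n) / real (m n) < 1) sequentially"
    by (rule sparse) simp
  have k_small: "eventually (\<lambda>n. real (k n) ^ 2 / real n < 1) sequentially"
    by (rule order_tendstoD(2)[OF assms(3)]) simp
  have sparse_const: "eventually (\<lambda>n. real n / real (k n) ^ 2 * ln (real n) / real (m n) < 1 / 1024) sequentially"
    by (rule sparse) simp
  have fine: "eventually (\<lambda>n. real (m n) / (real n / ln (real n)) < 1 / 400) sequentially"
    using order_tendstoD(2)[OF assms(6)[unfolded much_less_def], of "1 / 400"] by simp
  \<comment> \<open>Divergence of \<open>m\<close> is derived: eventually \<open>k^2 < n\<close>, so
    \<open>m > (n / k^2) ln n \<ge> ln n\<close>.\<close>
  have m_ge: "eventually (\<lambda>n. ln (real n) \<le> real (m n)) sequentially"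
    using sparse_one k_small eventually_ge_at_top[of 2]
  proof eventually_elim
    case (elim n)
    \<comment> \<open>Positivity matters here: division by zero yields 0, which would make the
      quotient bounds say nothing.\<close>
    then have m: "m n > 0" and k: "k n > 0" using assms(1,8) bin_partitionD(1) by fastforce+
    have "1 * ln (real n) \<le> real n / real (k n) ^ 2 * ln (real n)"
      using elim k by (intro mult_right_mono) (auto simp: field_simps)
    also have "\<dots> < real (m n)" using elim(1) m by (simp only: divide_less_eq_1_pos of_nat_0_less_iff)
    finally show ?case by simp
  qed
  have "filterlim (\<lambda>n. real (m n)) at_top sequentially"
    by (rule filterlim_at_top_mono[OF filterlim_compose[OF ln_at_top filterlim_real_sequentially] m_ge])
  then have m_lim: "filterlim m at_top sequentially"
    by (simp add: filterlim_sequentially_iff_filterlim_real)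
  have risk: "risk_bound m q \<longlonglongrightarrow> 0" by (rule risk_bound_tendsto_0[OF m_lim q])
  have bounds: "eventually (\<lambda>n.
      0 \<le> (SUP S\<in>{S. S \<subseteq> {..<n} \<and> card S = k n}. SUP A\<in>corr_class n S (\<rho> n).
           measure (mvn A) {x \<in> space (mvn A). gof_test n (m n) (I n) x = 0}) \<and>
      measure (mvn (1\<^sub>m n)) {x \<in> space (mvn (1\<^sub>m n)). gof_test n (m n) (I n) x = 1} +
         (SUP S\<in>{S. S \<subseteq> {..<n} \<and> card S = k n}. SUP A\<in>corr_class n S (\<rho> n).
           measure (mvn A) {x \<in> space (mvn A). gof_test n (m n) (I n) x = 0}) \<le> risk_bound m q n)
      sequentially"
    using sparse_const fine m_lim[THEN filterlim_at_top[THEN iffD1], rule_format, of 8]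
      eventually_ge_at_top[of 3]
  proof eventually_elim
    case (elim n)
    then have I: "bin_partition (m n) (I n)" and k: "2 \<le> k n" "k n \<le> n"
      and \<rho>: "0 < \<rho> n" "\<rho> n \<le> 1"
      using assms(1,2,8) by auto
    note ineq = threshold_deviation_bounds[of n "k n" "m n"]
    have le: "real (m n) \<le> real n" using ineq(1) elim k by simp
    \<comment> \<open>The root balances the terms of order \<open>\<epsilon>\<close> and
      \<open>q / \<epsilon>\<close>; the summand \<open>1 / n\<close> keeps
      \<open>\<epsilon>\<close> positive when \<open>q n = 0\<close>, as for
      \<open>\<rho> = 1\<close>.\<close>
    define \<epsilon> where "\<epsilon> = sqrt (q n) + 1 / real n"
    have q0: "q n \<ge> 0" using \<rho> by (simp add: q_def)
    have \<epsilon>: "\<epsilon> > 0" using elim q0 by (simp add: \<epsilon>_def add_nonneg_pos)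
    have q\<epsilon>: "q n / \<epsilon> \<le> sqrt (q n)"
    proof -
      have "q n = sqrt (q n) * sqrt (q n)" using q0 by simp
      also have "\<dots> \<le> sqrt (q n) * \<epsilon>" using q0 by (intro mult_left_mono) (auto simp: \<epsilon>_def)
      finally show ?thesis using \<epsilon> by (simp add: divide_le_eq)
    qed
    define b where "b = 2 * \<epsilon> + 2 * sqrt 2 * sqrt (q n) + exp (- (6 / 10) * ln (real n))"
    have "0 \<le> measure (mvn A) {x \<in> space (mvn A). gof_test n (m n) (I n) x = 0} \<and>
        measure (mvn A) {x \<in> space (mvn A). gof_test n (m n) (I n) x = 0} \<le> b"
      if S: "S \<subseteq> {..<n}" "card S = k n" and A: "A \<in> corr_class n S (\<rho> n)" for S A
    proof -
      have "S \<noteq> {}" using S k by auto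
      have "measure (mvn A) {x \<in> space (mvn A). gof_test n (m n) (I n) x = 0}
          \<le> 2 * \<epsilon> + 2 * sqrt 2 * q n / \<epsilon> + real (m n) * exp (- (16 / 10) * ln (real n))"
        unfolding q_def
        using ineq elim k S by (intro gof_test_type_2_error[OF I _ S(1) \<open>S \<noteq> {}\<close> A \<rho>(2) \<epsilon>]) auto
      moreover have "2 * sqrt 2 * q n / \<epsilon> \<le> 2 * sqrt 2 * sqrt (q n)"
        using mult_left_mono[OF q\<epsilon>, of "2 * sqrt 2"] by simp
      \<comment> \<open>Here \<open>m \<le> n\<close> absorbs the number of bins, leaving
        \<open>n\<close> to the power \<open>-6/10\<close>.\<close>
      moreover have "real (m n) * exp (- (16 / 10) * ln (real n)) \<le> exp (- (6 / 10) * ln (real n))"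
      proof -
        have "real (m n) * exp (- (16 / 10) * ln (real n)) \<le> exp (ln (real n)) * exp (- (16 / 10) * ln (real n))"
          using le elim by (intro mult_right_mono) auto
        also have "\<dots> = exp (- (6 / 10) * ln (real n))"
          unfolding exp_add[symmetric] by simp
        finally show ?thesis .
      qed
      ultimately have "measure (mvn A) {x \<in> space (mvn A). gof_test n (m n) (I n) x = 0} \<le> b"
        unfolding b_def by linarith
      then show ?thesis by simp
    qed
    then have inner: "0 \<le> (SUP A\<in>corr_class n S (\<rho> n).
          measure (mvn A) {x \<in> space (mvn A). gof_test n (m n) (I n) x = 0}) \<and>
        (SUP A\<in>corr_class n S (\<rho> n).
          measure (mvn A) {x \<in> space (mvn A). gof_test n (m n) (I n) x = 0}) \<le> b"
      if "S \<in> {S. S \<subseteq> {..<n} \<and> card S = k n}" for S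
      using that corr_class_nonempty[of S n "\<rho> n"] \<rho> by (intro cSUP_between) auto
    \<comment> \<open>The bound \<open>k n \<le> n\<close> enters here, as the outer supremum also
      needs a nonempty index set.\<close>
    have nonempty: "{S. S \<subseteq> {..<n} \<and> card S = k n} \<noteq> {}"
      using k(2) obtain_subset_with_card_n[of "k n" "{..<n}"] by (metis (mono_tags, lifting) card_lessThan empty_Collect_eq)
    have SUP: "0 \<le> (SUP S\<in>{S. S \<subseteq> {..<n} \<and> card S = k n}. SUP A\<in>corr_class n S (\<rho> n).
           measure (mvn A) {x \<in> space (mvn A). gof_test n (m n) (I n) x = 0}) \<and>
        (SUP S\<in>{S. S \<subseteq> {..<n} \<and> card S = k n}. SUP A\<in>corr_class n S (\<rho> n).
           measure (mvn A) {x \<in> space (mvn A). gof_test n (m n) (I n) x = 0}) \<le> b"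
      by (rule cSUP_between[OF nonempty inner])
    have "measure (mvn (1\<^sub>m n)) {x \<in> space (mvn (1\<^sub>m n)). gof_test n (m n) (I n) x = 1}
        \<le> real (m n) * exp (- (12 / 10) * ln (real (m n)))"
      using ineq elim k by (intro gof_test_type_1_error[OF I]) auto
    also have "\<dots> = exp (ln (real (m n))) * exp (- (12 / 10) * ln (real (m n)))"
      using elim by simp
    also have "\<dots> = exp (- (2 / 10) * ln (real (m n)))"
      unfolding exp_add[symmetric] by simp
    finally show ?case using SUP unfolding risk_bound_def b_def \<epsilon>_def by linarith
  qed
  show ?thesis
  proof (rule tendsto_sandwich[OF _ _ tendsto_const risk])
    show "eventually (\<lambda>n. 0 \<le> measure (mvn (1\<^sub>m n)) {x \<in> space (mvn (1\<^sub>m n)). gof_test n (m n) (I n) x = 1} +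
           (SUP S\<in>{S. S \<subseteq> {..<n} \<and> card S = k n}. SUP A\<in>corr_class n S (\<rho> n).
             measure (mvn A) {x \<in> space (mvn A). gof_test n (m n) (I n) x = 0})) sequentially"
      using bounds by eventually_elim simp
    show "eventually (\<lambda>n. measure (mvn (1\<^sub>m n)) {x \<in> space (mvn (1\<^sub>m n)). gof_test n (m n) (I n) x = 1} +
           (SUP S\<in>{S. S \<subseteq> {..<n} \<and> card S = k n}. SUP A\<in>corr_class n S (\<rho> n).
             measure (mvn A) {x \<in> space (mvn A). gof_test n (m n) (I n) x = 0}) \<le> risk_bound m q n) sequentially"
      using bounds by eventually_elim simp
  qed
qed

end
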